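(* Let $V_2=\{(z,w)\in\mathbb{D}^2:z^3=w^2\}$, and consider the convex set of holomorphic functions on $V_2$ with positive real part that take the value $1$ at $(0,0)$. Via composition with $h_2(z)=(z^2,z^3)$, $z\in\mathbb{D}$, this set is identified with the set $\mathcal{P}$ of holomorphic functions $\phi$ on $\mathbb{D}$ with positive real part, $\phi(0)=1$ and $\phi'(0)=0$; every $\phi\in\mathcal{P}$ is of the form $$\phi(z)=\int\frac{e^{i\theta}+z}{e^{i\theta}-z}\,d\mu(\theta)$$ for a probability measure $\mu$ on the unit circle satisfying $\int e^{-i\theta}d\mu(\theta)=0$. The extreme points of $\mathcal{P}$ are of exactly two sorts: those for which $\mu$ consists of two atoms of mass $1/2$ at diametrically opposite points of the circle, and those for which $\mu$ consists of three atoms located at the vertices of a triangle with $0$ in its interior, with masses that sum to $1$ and satisfy $\int e^{-i\theta}d\mu(\theta)=0$.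
   Context: $\mathbb{D}$ is the open unit disk in $\mathbb{C}$. A function on $V_2\subset\mathbb{C}^2$ is holomorphic if near every point of $V_2$ it is the restriction of a holomorphic function on a neighborhood in $\mathbb{C}^2$. *)

theory Defs
  imports
    "HOL-Complex_Analysis.Complex_Analysis"
    "HOL-Probability.Probability"
    "HOL-Library.Function_Algebras"
begin

text \<open>Pointwise real vector space structure on functions, so that \<open>convex\<close>, \<open>linear\<close> and
  \<open>extreme_point_of\<close> apply to sets of functions.\<close>

instantiation "fun" :: (type, scaleR) scaleR
begin

definition "r *\<^sub>R f = (\<lambda>x. r *\<^sub>R f x)"

instance ..

end

lemma scaleR_fun_apply [simp]: "(r *\<^sub>R f) x = r *\<^sub>R f x"
  by (simp add: scaleR_fun_def)

instance "fun" :: (type, real_vector) real_vector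
  by standard (simp_all add: fun_eq_iff scaleR_add_right scaleR_add_left)

text \<open>A function on a subset of the plane or of \<open>\<complex>\<^sup>2\<close> is represented below by the total function that
  agrees with it on that subset and vanishes outside: equality and the pointwise operations on
  total functions are then those of the functions on the subset.\<close>

definition holomorphic2_on :: "(complex \<times> complex \<Rightarrow> complex) \<Rightarrow> (complex \<times> complex) set \<Rightarrow> bool"
  where "holomorphic2_on g U \<longleftrightarrow>
    open U \<and> (\<forall>p\<in>U. \<exists>a b. (g has_derivative (\<lambda>(h, k). a * h + b * k)) (at p))"

definition holomorphic_on_variety ::
  "(complex \<times> complex \<Rightarrow> complex) \<Rightarrow> (complex \<times> complex) set \<Rightarrow> bool"
  where "holomorphic_on_variety F V \<longleftrightarrow>
    (\<forall>p\<in>V. \<exists>U g. p \<in> U \<and> holomorphic2_on g U \<and> (\<forall>q\<in>V \<inter> U. F q = g q))"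

definition V2 :: "(complex \<times> complex) set"
  where "V2 = {(z, w). z \<in> ball 0 1 \<and> w \<in> ball 0 1 \<and> z ^ 3 = w ^ 2}"

definition pos_V2 :: "(complex \<times> complex \<Rightarrow> complex) set"
  where "pos_V2 = {F. holomorphic_on_variety F V2 \<and> (\<forall>p\<in>V2. Re (F p) > 0) \<and> F (0, 0) = 1 \<and>
    (\<forall>p. p \<notin> V2 \<longrightarrow> F p = 0)}"

text \<open>The map \<open>h2\<close> sends the complement of the disk into the complement of \<open>V2\<close>, so composition with
  it respects the convention of vanishing outside the domain.\<close>

definition h2 :: "complex \<Rightarrow> complex \<times> complex"
  where "h2 z = (z ^ 2, z ^ 3)"

definition pos_disk :: "(complex \<Rightarrow> complex) set"
  where "pos_disk = {\<phi>. \<phi> holomorphic_on ball 0 1 \<and> (\<forall>z\<in>ball 0 1. Re (\<phi> z) > 0) \<and>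
    \<phi> 0 = 1 \<and> deriv \<phi> 0 = 0 \<and> (\<forall>z. z \<notin> ball 0 1 \<longrightarrow> \<phi> z = 0)}"

text \<open>Measures live on the circle itself, with \<open>\<zeta> = exp (\<i> * \<theta>)\<close> and
  \<open>cnj \<zeta> = exp (- \<i> * \<theta>)\<close>.\<close>

definition circle_measures :: "complex measure set"
  where "circle_measures = {\<mu>. prob_space \<mu> \<and> sets \<mu> = sets (restrict_space borel (sphere 0 1)) \<and>
    (\<integral>\<zeta>. cnj \<zeta> \<partial>\<mu>) = 0}"

definition herglotz :: "complex measure \<Rightarrow> complex \<Rightarrow> complex"
  where "herglotz \<mu> z = (if z \<in> ball 0 1 then (\<integral>\<zeta>. (\<zeta> + z) / (\<zeta> - z) \<partial>\<mu>) else 0)"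

definition consists_of_atoms :: "complex measure \<Rightarrow> complex set \<Rightarrow> bool"
  where "consists_of_atoms \<mu> S \<longleftrightarrow>
    S \<subseteq> space \<mu> \<and> (\<forall>\<zeta>\<in>S. measure \<mu> {\<zeta>} > 0) \<and> emeasure \<mu> (space \<mu> - S) = 0"

definition two_antipodal_atoms :: "complex measure \<Rightarrow> bool"
  where "two_antipodal_atoms \<mu> \<longleftrightarrow>
    (\<exists>\<zeta>. consists_of_atoms \<mu> {\<zeta>, - \<zeta>} \<and> measure \<mu> {\<zeta>} = 1 / 2 \<and> measure \<mu> {- \<zeta>} = 1 / 2)"

text \<open>The interior condition forces \<open>a\<close>, \<open>b\<close>, \<open>c\<close> to be the vertices of a nondegenerate triangle.
  The masses sum to 1 and balance at 0 for every member of \<open>circle_measures\<close>.\<close>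

definition three_triangle_atoms :: "complex measure \<Rightarrow> bool"
  where "three_triangle_atoms \<mu> \<longleftrightarrow>
    (\<exists>a b c. 0 \<in> interior (convex hull {a, b, c}) \<and> consists_of_atoms \<mu> {a, b, c})"

end

(* Extreme points. A measure whose topological support has at least four points carries a nonzero real
   combination w of indicators of four small disjoint balls around support points that is orthogonal
   to 1 and to cnj zeta (three real conditions); perturbing the density by w in both directions splits
   the Herglotz integral, and the two halves differ because the Herglotz integral of w is nonzero.
   A balanced measure with at most three support points is of one of the two stated sorts. Conversely,
   the mass of a point s is the radial limit of (1 - r) / 2 times the Herglotz integral at r s, so
   both ends of a segment through such an integral have representing measures supported on the same
   affinely independent points, where the balance condition determines the masses. *)

theory Submission
  imports Defs
begin

section \<open>Functions on the cuspidal curve\<close>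

text \<open>The three real conditions are the total mass (one) and the first moment (two), which is
  where the threshold of four support points comes from. The delicate point is that the Herglotz
  integral of \<open>w\<close> does not vanish. The argument for it asks for a weight that is a
  nonzero constant near one point of the circle and zero on a ring around that neighbourhood; this
  dictates both the use of indicators of balls and the ratio between their radius and the distance
  of their centres.

  The classification concerns every measure representing a given function, and the two ends of a
  segment come with representing measures about which nothing is known beforehand. They are
  therefore compared through point masses, which the functions themselves determine.

  On the side of the curve, every exponent except 1 is a sum of twos and threes, so the vanishing of
  the first Taylor coefficient is exactly what makes a power series in \<open>t\<close> a function
  of \<open>t ^ 2\<close> and \<open>t ^ 3\<close>.\<close>

lemma holomorphic2_on_add:
  assumes "holomorphic2_on f U" "holomorphic2_on g U"
  shows "holomorphic2_on (\<lambda>p. u * f p + v * g p) U"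
  unfolding holomorphic2_on_def
proof (intro conjI ballI)
  show "open U" using assms by (simp add: holomorphic2_on_def)
  fix p assume "p \<in> U"
  then obtain a b c d where
    f: "(f has_derivative (\<lambda>(h, k). a * h + b * k)) (at p)" and
    g: "(g has_derivative (\<lambda>(h, k). c * h + d * k)) (at p)"
    using assms unfolding holomorphic2_on_def by blast
  have "((\<lambda>p. u * f p + v * g p) has_derivative
      (\<lambda>x. u * (\<lambda>(h, k). a * h + b * k) x + v * (\<lambda>(h, k). c * h + d * k) x)) (at p)"
    by (intro derivative_intros f g)
  also have "(\<lambda>x. u * (\<lambda>(h, k). a * h + b * k) x + v * (\<lambda>(h, k). c * h + d * k) x) =
      (\<lambda>(h, k). (u * a + v * c) * h + (u * b + v * d) * k)"
    by (auto simp: fun_eq_iff algebra_simps)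
  finally show "\<exists>a b. ((\<lambda>p. u * f p + v * g p) has_derivative (\<lambda>(h, k). a * h + b * k)) (at p)"
    by blast
qed

lemma holomorphic2_on_subset:
  "holomorphic2_on g U \<Longrightarrow> open U' \<Longrightarrow> U' \<subseteq> U \<Longrightarrow> holomorphic2_on g U'"
  by (auto simp: holomorphic2_on_def)

lemma holomorphic_on_variety_add:
  assumes "holomorphic_on_variety F V" "holomorphic_on_variety G V"
  shows "holomorphic_on_variety (\<lambda>p. u * F p + v * G p) V"
  unfolding holomorphic_on_variety_def
proof
  fix p assume p: "p \<in> V"
  obtain U f where f: "p \<in> U" "holomorphic2_on f U" "\<forall>q\<in>V \<inter> U. F q = f q"
    using assms(1) p unfolding holomorphic_on_variety_def by meson
  obtain U' g where g: "p \<in> U'" "holomorphic2_on g U'" "\<forall>q\<in>V \<inter> U'. G q = g q"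
    using assms(2) p unfolding holomorphic_on_variety_def by meson
  have "open (U \<inter> U')" using f g by (auto simp: holomorphic2_on_def)
  then have "holomorphic2_on (\<lambda>p. u * f p + v * g p) (U \<inter> U')"
    by (intro holomorphic2_on_add) (auto intro: holomorphic2_on_subset f g)
  then show "\<exists>U h. p \<in> U \<and> holomorphic2_on h U \<and> (\<forall>q\<in>V \<inter> U. u * F q + v * G q = h q)"
    using f g by (intro exI[of _ "U \<inter> U'"] exI[of _ "\<lambda>p. u * f p + v * g p"]) auto
qed

lemma convex_pos_V2: "convex pos_V2"
proof (rule convexI)
  fix F G and u v :: real
  assume FG: "F \<in> pos_V2" "G \<in> pos_V2" and uv: "0 \<le> u" "0 \<le> v" "u + v = 1"
  have "Re ((u *\<^sub>R F + v *\<^sub>R G) p) > 0" if "p \<in> V2" for p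
  proof -
    have "Re (F p) > 0" "Re (G p) > 0" using FG that by (auto simp: pos_V2_def)
    then have "u * Re (F p) + v * Re (G p) > 0"
      using uv by (cases "u = 0") (auto intro: add_pos_nonneg)
    then show ?thesis by simp
  qed
  moreover have "holomorphic_on_variety (u *\<^sub>R F + v *\<^sub>R G) V2"
    using holomorphic_on_variety_add[of F V2 G "of_real u" "of_real v"] FG
    by (simp add: pos_V2_def plus_fun_def scaleR_fun_def scaleR_conv_of_real)
  moreover have "(u *\<^sub>R F + v *\<^sub>R G) (0, 0) = 1"
    using FG uv by (simp add: pos_V2_def scaleR_conv_of_real flip: of_real_add)
  ultimately show "u *\<^sub>R F + v *\<^sub>R G \<in> pos_V2"
    using FG by (simp add: pos_V2_def)
qed

section \<open>Pullback along the parametrization of the cusp\<close>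

lemma pos_V2_outside: "F \<in> pos_V2 \<Longrightarrow> p \<notin> V2 \<Longrightarrow> F p = 0"
  unfolding pos_V2_def by (simp del: split_paired_All)

lemma linear_comp_right: "linear (\<lambda>F :: 'b \<Rightarrow> 'c::real_vector. F \<circ> (h :: 'a \<Rightarrow> 'b))"
  by (rule linearI) (auto simp: fun_eq_iff)

text \<open>Away from the cusp the parameter is recovered as \<open>y / x\<close>: by
  \<open>y ^ 2 = x ^ 3\<close> its square is \<open>x\<close> and its cube is \<open>y\<close>. The
  first of these also puts it in the disk.\<close>

lemma h2_image: "h2 ` ball 0 1 = V2"
proof (intro equalityI subsetI)
  fix p assume "p \<in> h2 ` ball 0 1"
  then show "p \<in> V2"
    by (auto simp: h2_def V2_def norm_power power_less_one_iff simp flip: power_mult)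
next
  fix p assume "p \<in> V2"
  moreover obtain x y where p: "p = (x, y)" by (cases p)
  ultimately have xy: "(x, y) \<in> V2" by simp
  have "(x, y) \<in> h2 ` ball 0 1"
  proof (cases "x = 0")
    case True
    then have "h2 0 = (x, y)" using xy by (auto simp: V2_def h2_def)
    then show ?thesis by (metis centre_in_ball image_eqI zero_less_one)
  next
    case False
    have e: "y ^ 2 = x ^ 3" and x1: "norm x < 1" using xy by (auto simp: V2_def)
    then have "y \<noteq> 0" using False by (metis power_not_zero zero_power2)
    have 1: "(y / x) ^ 2 = x"
      using False by (simp add: power_divide e) (simp add: eval_nat_numeral)
    have "(y / x) ^ 3 = (y / x) ^ 2 * (y / x)" by (simp add: power2_eq_square power3_eq_cube)
    also have "\<dots> = y" using False 1 by simp
    finally have "h2 (y / x) = (x, y)" using 1 by (simp add: h2_def)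
    moreover have "norm (y / x) ^ 2 < 1" using 1 x1 by (metis norm_power)
    then have "y / x \<in> ball 0 1" by (simp add: power_less_one_iff abs_square_less_1)
    ultimately show ?thesis by (metis image_eqI)
  qed
  then show "p \<in> h2 ` ball 0 1" by (simp add: p)
qed

lemma h2_in_V2_iff: "h2 z \<in> V2 \<longleftrightarrow> z \<in> ball 0 1"
proof
  assume "h2 z \<in> V2"
  then have "norm z ^ 2 < 1" by (auto simp: h2_def V2_def norm_power)
  then show "z \<in> ball 0 1" by (simp add: abs_square_less_1)
qed (use h2_image in blast)

lemma has_field_derivative_comp_h2:
  assumes "(g has_derivative (\<lambda>(h, k). a * h + b * k)) (at (h2 z))"
  shows "((\<lambda>t. g (h2 t)) has_field_derivative (a * (2 * z) + b * (3 * z ^ 2))) (at z)"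
proof -
  have h: "(h2 has_derivative (\<lambda>t. (2 * z * t, 3 * z ^ 2 * t))) (at z)"
    unfolding h2_def
    by (auto intro!: derivative_eq_intros simp: fun_eq_iff)
  have "((\<lambda>t. g (h2 t)) has_derivative
      (\<lambda>t. (\<lambda>(h, k). a * h + b * k) (2 * z * t, 3 * z ^ 2 * t))) (at z)"
    by (rule has_derivative_compose[OF h assms])
  then show ?thesis
    unfolding has_field_derivative_def by (rule has_derivative_eq_rhs) (auto simp: algebra_simps)
qed

text \<open>Chain rule applied to a local holomorphic extension of \<open>F\<close>. The derivative
  is kept in this shape because it visibly vanishes at \<open>z = 0\<close>: the velocity of
  \<open>h2\<close> is zero at the cusp, and this is the source of the condition
  \<open>deriv \<phi> 0 = 0\<close>.\<close>

lemma comp_h2_has_field_derivative: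
  assumes "F \<in> pos_V2" "z \<in> ball 0 1"
  shows "\<exists>a b. ((F \<circ> h2) has_field_derivative (a * (2 * z) + b * (3 * z ^ 2))) (at z)"
proof -
  have "h2 z \<in> V2" using assms(2) by (simp add: h2_in_V2_iff)
  then obtain U g where U: "h2 z \<in> U" "holomorphic2_on g U" "\<forall>q\<in>V2 \<inter> U. F q = g q"
    using assms(1) unfolding pos_V2_def holomorphic_on_variety_def by blast
  then obtain a b where "(g has_derivative (\<lambda>(h, k). a * h + b * k)) (at (h2 z))"
    unfolding holomorphic2_on_def by blast
  then have 1: "((\<lambda>t. g (h2 t)) has_field_derivative (a * (2 * z) + b * (3 * z ^ 2))) (at z)"
    by (rule has_field_derivative_comp_h2)
  have "continuous_on UNIV h2" unfolding h2_def by (intro continuous_intros)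
  moreover have "open U" using U by (simp add: holomorphic2_on_def)
  ultimately have "open (h2 -` U)" by (simp add: open_vimage)
  then have "open (h2 -` U \<inter> ball 0 1)" by blast
  then have "((F \<circ> h2) has_field_derivative (a * (2 * z) + b * (3 * z ^ 2))) (at z)"
    by (rule has_field_derivative_transform_within_open[OF 1])
       (use assms U in \<open>auto simp: h2_in_V2_iff\<close>)
  then show ?thesis by blast
qed

lemma comp_h2_in_pos_disk:
  assumes "F \<in> pos_V2"
  shows "F \<circ> h2 \<in> pos_disk"
proof -
  have "(F \<circ> h2) holomorphic_on ball 0 1"
    using comp_h2_has_field_derivative[OF assms] by (subst holomorphic_on_open) blast+
  moreover have "deriv (F \<circ> h2) 0 = 0"
    using comp_h2_has_field_derivative[OF assms, of 0] by (auto intro: DERIV_imp_deriv)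
  moreover have "F (h2 0) = 1" using assms by (simp add: pos_V2_def h2_def)
  moreover have "Re (F (h2 z)) > 0" if "z \<in> ball 0 1" for z
    using assms that h2_in_V2_iff by (auto simp: pos_V2_def)
  moreover have "F (h2 z) = 0" if "z \<notin> ball 0 1" for z
  proof -
    have "h2 z \<notin> V2" using that by (simp add: h2_in_V2_iff)
    then show ?thesis by (rule pos_V2_outside[OF assms])
  qed
  ultimately show ?thesis by (auto simp: pos_disk_def)
qed

text \<open>In \<open>\<Sum>n. a n * t ^ n\<close> with \<open>a 1 = 0\<close>, the even terms are powers of \<open>t\<^sup>2\<close> and the odd ones are
  \<open>t ^ 3\<close> times powers of \<open>t\<^sup>2\<close>.\<close>

lemma holomorphic_split_even_odd:
  assumes holo: "\<phi> holomorphic_on ball 0 1" and d0: "deriv \<phi> 0 = 0"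
  obtains E D where "E holomorphic_on ball 0 1" "D holomorphic_on ball 0 1"
    "\<And>t. t \<in> ball 0 1 \<Longrightarrow> \<phi> t = E (t ^ 2) + t ^ 3 * D (t ^ 2)"
proof -
  define a where "a n = (deriv ^^ n) \<phi> 0 / fact n" for n
  have a1: "a 1 = 0" using d0 by (simp add: a_def)
  have sums: "(\<lambda>n. a n * t ^ n) sums \<phi> t" if "t \<in> ball 0 1" for t
    using holomorphic_power_series[OF holo that] by (simp add: a_def)
  \<comment> \<open>Convergence at a radius strictly between \<open>norm t\<close> and 1 gives
    absolute convergence at \<open>t\<close>, which is inherited by the subseries of even and of odd
    index.\<close>
  have abs: "summable (\<lambda>n. norm (a n * t ^ n))" if "t \<in> ball 0 1" for t
  proof -
    have "norm t < 1" using that by simp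
    then obtain s where s: "norm t < s" "s < 1" using dense by blast
    then have "summable (\<lambda>n. a n * of_real s ^ n)"
      using sums[of "of_real s"] norm_ge_zero[of t] by (force dest: sums_summable)
    then show ?thesis
      by (rule powser_insidea) (use s norm_ge_zero[of t] in auto)
  qed
  have ev: "summable (\<lambda>n. a (2 * n) * s ^ n)" and od: "summable (\<lambda>n. a (2 * n + 3) * s ^ n)"
    if "s \<in> ball 0 1" for s
  proof -
    \<comment> \<open>A square root of \<open>s\<close> turns the series in \<open>s\<close> into a
      subseries of the expansion at \<open>t\<close>. The odd one carries an extra factor
      \<open>t ^ 3\<close> to be divided out, hence the separate case \<open>t = 0\<close>.\<close>
    define t where "t = csqrt s"
    have t2: "t ^ 2 = s" by (simp add: t_def)
    have t: "t \<in> ball 0 1" using that by (simp add: t_def real_sqrt_lt_1_iff)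
    have "summable (\<lambda>n. norm (a (2 * n) * t ^ (2 * n)))"
      using summable_reindex[OF abs[OF t], of "\<lambda>n. 2 * n"]
      by (simp add: inj_on_def o_def)
    then show "summable (\<lambda>n. a (2 * n) * s ^ n)"
      by (auto simp: power_mult t2 dest: summable_norm_cancel)
    have "summable (\<lambda>n. norm (a (2 * n + 3) * t ^ (2 * n + 3)))"
      using summable_reindex[OF abs[OF t], of "\<lambda>n. 2 * n + 3"]
      by (simp add: inj_on_def o_def)
    then have "summable (\<lambda>n. a (2 * n + 3) * t ^ (2 * n + 3))"
      by (rule summable_norm_cancel)
    also have "(\<lambda>n. a (2 * n + 3) * t ^ (2 * n + 3)) = (\<lambda>n. a (2 * n + 3) * s ^ n * t ^ 3)"
      by (simp only: power_add power_mult t2 mult.assoc)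
    finally have *: "summable (\<lambda>n. a (2 * n + 3) * s ^ n * t ^ 3)" .
    show "summable (\<lambda>n. a (2 * n + 3) * s ^ n)"
    proof (cases "t = 0")
      case True
      then have "s = 0" using t2 by simp
      then show ?thesis by (auto intro!: summable_finite[of "{0}"] simp: power_0_left split: if_splits)
    next
      case False
      then show ?thesis using summable_mult2[OF *, of "inverse (t ^ 3)"] by (simp add: mult.assoc)
    qed
  qed
  define E where "E s = (\<Sum>n. a (2 * n) * s ^ n)" for s
  define D where "D s = (\<Sum>n. a (2 * n + 3) * s ^ n)" for s
  show ?thesis
  proof
    show "E holomorphic_on ball 0 1"
      by (rule power_series_holomorphic[where a = "\<lambda>n. a (2 * n)"])
         (use ev in \<open>auto simp: E_def intro!: summable_sums\<close>)
    show "D holomorphic_on ball 0 1"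
      by (rule power_series_holomorphic[where a = "\<lambda>n. a (2 * n + 3)"])
         (use od in \<open>auto simp: D_def intro!: summable_sums\<close>)
    fix t :: complex assume t: "t \<in> ball 0 1"
    then have t2: "t ^ 2 \<in> ball 0 1" by (simp add: norm_power power_less_one_iff)
    have "(\<lambda>n. t ^ 3 * (a (2 * n + 3) * (t ^ 2) ^ n)) sums (t ^ 3 * D (t ^ 2))"
      unfolding D_def by (intro sums_mult summable_sums od t2)
    \<comment> \<open>The odd terms from exponent 3 on. Shifting the index back adds only the term
      \<open>a 1 * t\<close>, which is zero.\<close>
    then have "(\<lambda>n. a (2 * Suc n + 1) * t ^ (2 * Suc n + 1)) sums (t ^ 3 * D (t ^ 2))"
      by (simp add: power_mult_distrib power_add mult_ac eval_nat_numeral)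
    then have 1: "(\<lambda>n. a (2 * n + 1) * t ^ (2 * n + 1)) sums (t ^ 3 * D (t ^ 2))"
      by (subst (asm) sums_Suc_iff) (use a1 in simp)
    have 2: "(\<lambda>n. a (2 * n) * t ^ (2 * n)) sums E (t ^ 2)"
      using summable_sums[OF ev[OF t2]] by (simp add: E_def power_mult)
    have "(\<lambda>n. \<Sum>m = n * 2..<n * 2 + 2. a m * t ^ m) sums \<phi> t"
      by (rule sums_group[OF sums[OF t]]) auto
    also have "(\<lambda>n. \<Sum>m = n * 2..<n * 2 + 2. a m * t ^ m) =
        (\<lambda>n. a (2 * n) * t ^ (2 * n) + a (2 * n + 1) * t ^ (2 * n + 1))"
      by (simp add: fun_eq_iff mult.commute)
    finally show "\<phi> t = E (t ^ 2) + t ^ 3 * D (t ^ 2)"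
      using sums_add[OF 2 1] sums_unique2 by blast
  qed
qed

text \<open>The even-odd split becomes the formula \<open>E x + y * D x\<close> under
  \<open>x = t ^ 2\<close>, \<open>y = t ^ 3\<close>. It is holomorphic on the disk times the plane,
  so one ambient function serves as the local extension at every point of \<open>V2\<close>.\<close>

lemma comp_h2_surj:
  assumes "\<phi> \<in> pos_disk"
  shows "\<exists>F\<in>pos_V2. F \<circ> h2 = \<phi>"
proof -
  have phi: "\<phi> holomorphic_on ball 0 1" "deriv \<phi> 0 = 0" "\<And>z. z \<in> ball 0 1 \<Longrightarrow> Re (\<phi> z) > 0"
    "\<phi> 0 = 1" "\<And>z. z \<notin> ball 0 1 \<Longrightarrow> \<phi> z = 0"
    using assms by (auto simp: pos_disk_def)
  obtain E D where E: "E holomorphic_on ball 0 1" and D: "D holomorphic_on ball 0 1"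
    and eq: "\<And>t. t \<in> ball 0 1 \<Longrightarrow> \<phi> t = E (t ^ 2) + t ^ 3 * D (t ^ 2)"
    using holomorphic_split_even_odd[OF phi(1,2)] by blast
  define g where "g = (\<lambda>(x, y). E x + y * D x)"
  define F where "F p = (if p \<in> V2 then g p else 0)" for p
  have gh: "g (h2 t) = \<phi> t" if "t \<in> ball 0 1" for t
    using eq[OF that] by (simp add: g_def h2_def)
  have comp: "F \<circ> h2 = \<phi>"
    using gh phi(5) h2_in_V2_iff by (force simp: F_def fun_eq_iff)
  have "holomorphic2_on g (ball 0 1 \<times> UNIV)"
    unfolding holomorphic2_on_def
  proof (intro conjI ballI)
    fix p :: "complex \<times> complex" assume p: "p \<in> ball 0 1 \<times> UNIV"
    have E': "(E has_derivative (*) (deriv E (fst p))) (at (fst p))"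
      and D': "(D has_derivative (*) (deriv D (fst p))) (at (fst p))"
      using holomorphic_derivI[OF E open_ball, of "fst p"]
        holomorphic_derivI[OF D open_ball, of "fst p"] p
      unfolding has_field_derivative_def by auto
    have "((\<lambda>p. E (fst p) + snd p * D (fst p)) has_derivative
      (\<lambda>h. deriv E (fst p) * fst h + (snd p * (deriv D (fst p) * fst h) + snd h * D (fst p)))) (at p)"
      by (intro derivative_intros has_derivative_compose[where f = fst and g = E, OF _ E']
        has_derivative_compose[where f = fst and g = D, OF _ D'])
    also have "(\<lambda>p. E (fst p) + snd p * D (fst p)) = g"
      by (auto simp: g_def)
    also have "(\<lambda>h. deriv E (fst p) * fst h + (snd p * (deriv D (fst p) * fst h) + snd h * D (fst p))) =
      (\<lambda>(h, k). (deriv E (fst p) + snd p * deriv D (fst p)) * h + D (fst p) * k)"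
      by (auto simp: fun_eq_iff algebra_simps)
    finally show "\<exists>a b. (g has_derivative (\<lambda>(h, k). a * h + b * k)) (at p)" by blast
  qed (simp add: open_Times)
  moreover have "V2 \<subseteq> ball 0 1 \<times> UNIV" by (auto simp: V2_def)
  ultimately have "holomorphic_on_variety F V2"
    unfolding holomorphic_on_variety_def
    by (intro ballI exI[of _ "ball 0 1 \<times> UNIV"] exI[of _ g] conjI) (auto simp: F_def simp del: split_paired_All)
  moreover have "Re (F p) > 0" if "p \<in> V2" for p
  proof -
    have "p \<in> h2 ` ball 0 1" using that by (simp only: h2_image)
    then obtain t where "t \<in> ball 0 1" "p = h2 t" by (rule imageE)
    then show ?thesis using phi(3) gh that by (simp add: F_def)
  qed
  moreover have "F (0, 0) = 1"
    using fun_cong[OF comp, of 0] phi(4) by (simp add: h2_def)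
  ultimately have "F \<in> pos_V2"
    unfolding pos_V2_def mem_Collect_eq by (intro conjI ballI) (simp_all add: F_def)
  then show ?thesis using comp by blast
qed

lemma bij_betw_comp_h2: "bij_betw (\<lambda>F. F \<circ> h2) pos_V2 pos_disk"
  unfolding bij_betw_def
proof
  show "inj_on (\<lambda>F. F \<circ> h2) pos_V2"
  proof (rule inj_onI, rule ext)
    fix F G p assume FG: "F \<in> pos_V2" "G \<in> pos_V2" and eq: "F \<circ> h2 = G \<circ> h2"
    show "F p = G p"
    proof (cases "p \<in> V2")
      case True
      then have "p \<in> h2 ` ball 0 1" by (simp only: h2_image)
      then obtain t where "p = h2 t" by (rule imageE)
      then show ?thesis using fun_cong[OF eq, of t] by simp
    next
      case False
      then show ?thesis using FG[THEN pos_V2_outside] by simp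
    qed
  qed
  show "(\<lambda>F. F \<circ> h2) ` pos_V2 = pos_disk"
    using comp_h2_in_pos_disk comp_h2_surj by fastforce
qed

section \<open>Herglotz integrals of weighted measures\<close>

text \<open>Multiplying through by \<open>cnj (\<zeta> - z)\<close> leaves the real number
  \<open>1 - norm z ^ 2\<close> plus a difference of conjugates, which is purely imaginary. The
  result is the Poisson kernel.\<close>

lemma Re_herglotz_kernel:
  fixes \<zeta> z :: complex
  assumes "norm \<zeta> = 1" "\<zeta> \<noteq> z"
  shows "Re ((\<zeta> + z) / (\<zeta> - z)) = (1 - norm z ^ 2) / norm (\<zeta> - z) ^ 2"
proof -
  have "(\<zeta> + z) * cnj (\<zeta> - z) = (\<zeta> * cnj \<zeta> - z * cnj z) + (z * cnj \<zeta> - cnj (z * cnj \<zeta>))"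
    by (simp add: algebra_simps)
  also have "\<zeta> * cnj \<zeta> - z * cnj z = of_real (1 - norm z ^ 2)"
    using assms(1) by (simp add: complex_norm_square[symmetric] flip: of_real_power)
  finally have "Re ((\<zeta> + z) * cnj (\<zeta> - z)) = 1 - norm z ^ 2" by simp
  then show ?thesis by (simp add: Re_complex_div_eq_0 complex_div_cnj[of "\<zeta> + z"] flip: of_real_power)
qed

text \<open>Splits off a Cauchy kernel, so that holomorphy and the derivative at 0 can be obtained
  from the Cauchy transform.\<close>

lemma herglotz_kernel_eq:
  fixes \<zeta> z :: complex
  assumes "\<zeta> \<noteq> z"
  shows "(\<zeta> + z) / (\<zeta> - z) = 1 + 2 * z * (1 / (\<zeta> - z))"
  using assms by (simp add: field_simps)

lemma norm_herglotz_kernel_le: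
  fixes \<zeta> z :: complex
  assumes "norm \<zeta> = 1" "norm z < 1"
  shows "norm ((\<zeta> + z) / (\<zeta> - z)) \<le> 2 / (1 - norm z)"
proof -
  have "norm (\<zeta> + z) \<le> 2" using assms norm_triangle_ineq[of \<zeta> z] by simp
  moreover have "1 - norm z \<le> norm (\<zeta> - z)" using assms norm_triangle_ineq2[of \<zeta> z] by simp
  ultimately show ?thesis
    unfolding norm_divide using assms(2) by (intro frac_le) auto
qed

locale circle_measure = finite_measure M for M :: "complex measure" +
  assumes sets_M: "sets M = sets (restrict_space borel (sphere 0 1))"
begin

lemma space_M: "space M = sphere 0 1"
  using sets_eq_imp_space_eq[OF sets_M] by (simp add: space_restrict_space)

lemma norm_eq_1: "\<zeta> \<in> space M \<Longrightarrow> norm \<zeta> = 1"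
  by (simp add: space_M)

lemma measurable_M [measurable (raw)]: "f \<in> borel_measurable borel \<Longrightarrow> f \<in> borel_measurable M"
  using measurable_cong_sets[OF sets_M refl] measurable_restrict_space1 by blast

lemma Int_sphere_in_sets: "B \<in> sets borel \<Longrightarrow> B \<inter> sphere 0 1 \<in> sets M"
  unfolding sets_M sets_restrict_space by (auto simp: Int_commute)

lemma integrable_boundedI:
  fixes f :: "complex \<Rightarrow> 'b::{banach, second_countable_topology}"
  assumes "f \<in> borel_measurable borel" "\<And>\<zeta>. norm \<zeta> = 1 \<Longrightarrow> norm (f \<zeta>) \<le> C"
  shows "integrable M f"
  by (rule integrable_const_bound[of _ C]) (use assms norm_eq_1 in auto)

text \<open>The Herglotz integral of the signed measure with density \<open>w\<close> against
  \<open>M\<close>. With the density inside the integrand, \<open>M\<close> and its perturbations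
  are handled over one fixed measure.\<close>

definition wherglotz :: "(complex \<Rightarrow> real) \<Rightarrow> complex \<Rightarrow> complex"
  where "wherglotz w z = (\<integral>\<zeta>. of_real (w \<zeta>) * ((\<zeta> + z) / (\<zeta> - z)) \<partial>M)"

lemma integrable_wherglotz:
  assumes "w \<in> borel_measurable borel" "\<And>\<zeta>. norm \<zeta> = 1 \<Longrightarrow> \<bar>w \<zeta>\<bar> \<le> C" "norm z < 1"
  shows "integrable M (\<lambda>\<zeta>. of_real (w \<zeta>) * ((\<zeta> + z) / (\<zeta> - z)))"
proof (rule integrable_boundedI)
  show "(\<lambda>\<zeta>. complex_of_real (w \<zeta>) * ((\<zeta> + z) / (\<zeta> - z))) \<in> borel_measurable borel"
    using assms(1) by measurable
  show "norm (complex_of_real (w \<zeta>) * ((\<zeta> + z) / (\<zeta> - z))) \<le> C * (2 / (1 - norm z))"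
    if "norm \<zeta> = 1" for \<zeta>
    unfolding norm_mult
    by (intro mult_mono norm_herglotz_kernel_le) (use assms that in \<open>auto intro: order_trans[OF abs_ge_zero]\<close>)
qed

text \<open>On the circle \<open>1 / (\<zeta> - z)\<close> is a geometric series in
  \<open>z / \<zeta>\<close>, dominated by \<open>C * norm z ^ n\<close>. Integrating term by term
  gives a power series whose coefficients are moments of the weighted measure.\<close>

lemma cauchy_transform_holomorphic:
  assumes w: "w \<in> borel_measurable borel" "\<And>\<zeta>. norm \<zeta> = 1 \<Longrightarrow> \<bar>w \<zeta>\<bar> \<le> C"
  shows "(\<lambda>z. \<integral>\<zeta>. of_real (w \<zeta>) * (1 / (\<zeta> - z)) \<partial>M) holomorphic_on ball 0 1"
proof (rule power_series_holomorphic)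
  fix z :: complex assume "z \<in> ball 0 1"
  then have z: "norm z < 1" by simp
  note [measurable] = w(1)
  \<comment> \<open>The factor \<open>z - 0\<close> gives the terms the form of a power series
    centred at 0.\<close>
  define f where "f n \<zeta> = of_real (w \<zeta>) * (1 / \<zeta>) ^ Suc n * (z - 0) ^ n" for n :: nat and \<zeta> :: complex
  have bound: "norm (f n \<zeta>) \<le> C * norm z ^ n" if "norm \<zeta> = 1" for n \<zeta>
    using w(2)[OF that] that
    by (simp add: f_def norm_mult norm_power norm_divide mult_right_mono)
  have int: "integrable M (f n)" for n
    by (rule integrable_boundedI[OF _ bound]) (simp add: f_def)
  have C: "C \<ge> 0" using w(2)[of 1] by simp
  have sm: "summable (\<lambda>n. C * norm z ^ n)"
    using z by (intro summable_mult summable_geometric) simp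
  have "(\<lambda>n. integral\<^sup>L M (f n)) sums (\<integral>\<zeta>. (\<Sum>n. f n \<zeta>) \<partial>M)"
  proof (rule sums_integral[OF int])
    show "AE \<zeta> in M. summable (\<lambda>n. norm (f n \<zeta>))"
      by (rule AE_I2, rule summable_comparison_test'[OF sm]) (use bound norm_eq_1 in auto)
    have "summable (\<lambda>n. C * norm z ^ n * measure M (space M))"
      by (rule summable_mult2[OF sm])
    moreover have "norm (\<integral>\<zeta>. norm (f n \<zeta>) \<partial>M) \<le> C * norm z ^ n * measure M (space M)" for n
    proof -
      have "(\<integral>\<zeta>. norm (f n \<zeta>) \<partial>M) \<le> (\<integral>\<zeta>. C * norm z ^ n \<partial>M)"
        by (rule integral_mono) (use int bound norm_eq_1 in auto)
      then show ?thesis by (simp add: mult_ac integral_nonneg_AE)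
    qed
    ultimately show "summable (\<lambda>n. \<integral>\<zeta>. norm (f n \<zeta>) \<partial>M)"
      by (rule summable_comparison_test'[where N = 0])
  qed
  also have "(\<integral>\<zeta>. (\<Sum>n. f n \<zeta>) \<partial>M) = (\<integral>\<zeta>. of_real (w \<zeta>) * (1 / (\<zeta> - z)) \<partial>M)"
  proof (rule Bochner_Integration.integral_cong[OF refl])
    fix \<zeta> assume "\<zeta> \<in> space M"
    then have \<zeta>: "norm \<zeta> = 1" by (rule norm_eq_1)
    then have nz: "\<zeta> \<noteq> 0" "\<zeta> \<noteq> z" using z by auto
    have "(\<lambda>n. of_real (w \<zeta>) * (1 / \<zeta>) * (z / \<zeta>) ^ n) sums (of_real (w \<zeta>) * (1 / \<zeta>) * (1 / (1 - z / \<zeta>)))"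
      by (intro sums_mult geometric_sums) (use z \<zeta> in \<open>simp add: norm_divide\<close>)
    moreover have "of_real (w \<zeta>) * (1 / \<zeta>) * (z / \<zeta>) ^ n = f n \<zeta>" for n
      by (simp add: f_def power_divide)
    moreover have "of_real (w \<zeta>) * (1 / \<zeta>) * (1 / (1 - z / \<zeta>)) = of_real (w \<zeta>) * (1 / (\<zeta> - z))"
      using nz by (simp add: field_simps)
    ultimately show "(\<Sum>n. f n \<zeta>) = of_real (w \<zeta>) * (1 / (\<zeta> - z))"
      by (simp add: sums_iff)
  qed
  also have "(\<lambda>n. integral\<^sup>L M (f n)) = (\<lambda>n. (\<integral>\<zeta>. of_real (w \<zeta>) * (1 / \<zeta>) ^ Suc n \<partial>M) * (z - 0) ^ n)"
    by (simp only: f_def[abs_def] integral_mult_left_zero)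
  finally show "(\<lambda>n. (\<integral>\<zeta>. of_real (w \<zeta>) * (1 / \<zeta>) ^ Suc n \<partial>M) * (z - 0) ^ n) sums
      (\<integral>\<zeta>. of_real (w \<zeta>) * (1 / (\<zeta> - z)) \<partial>M)" .
qed

lemma wherglotz_eq:
  assumes w: "w \<in> borel_measurable borel" "\<And>\<zeta>. norm \<zeta> = 1 \<Longrightarrow> \<bar>w \<zeta>\<bar> \<le> C"
    and z: "norm z < 1"
  shows "wherglotz w z = of_real (\<integral>\<zeta>. w \<zeta> \<partial>M) + 2 * z * (\<integral>\<zeta>. of_real (w \<zeta>) * (1 / (\<zeta> - z)) \<partial>M)"
proof -
  note [measurable] = w(1)
  have i1: "integrable M w" using w by (intro integrable_boundedI[of _ C]) auto
  have i2: "integrable M (\<lambda>\<zeta>. of_real (w \<zeta>) * (1 / (\<zeta> - z)))"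
  proof (rule integrable_boundedI)
    show "(\<lambda>\<zeta>. complex_of_real (w \<zeta>) * (1 / (\<zeta> - z))) \<in> borel_measurable borel" by measurable
    show "norm (complex_of_real (w \<zeta>) * (1 / (\<zeta> - z))) \<le> C * (1 / (1 - norm z))" if "norm \<zeta> = 1" for \<zeta>
      unfolding norm_mult norm_divide
      by (intro mult_mono frac_le)
        (use w(2)[OF that] z norm_triangle_ineq2[of \<zeta> z] that in \<open>auto intro: order_trans[OF abs_ge_zero]\<close>)
  qed
  have "wherglotz w z = (\<integral>\<zeta>. of_real (w \<zeta>) + 2 * z * (of_real (w \<zeta>) * (1 / (\<zeta> - z))) \<partial>M)"
    unfolding wherglotz_def
  proof (rule Bochner_Integration.integral_cong[OF refl])
    fix \<zeta> assume "\<zeta> \<in> space M"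
    then have "\<zeta> \<noteq> z" using z norm_eq_1 by force
    then show "of_real (w \<zeta>) * ((\<zeta> + z) / (\<zeta> - z)) = of_real (w \<zeta>) + 2 * z * (of_real (w \<zeta>) * (1 / (\<zeta> - z)))"
      by (subst herglotz_kernel_eq) (auto simp: algebra_simps)
  qed
  also have "\<dots> = of_real (\<integral>\<zeta>. w \<zeta> \<partial>M) + 2 * z * (\<integral>\<zeta>. of_real (w \<zeta>) * (1 / (\<zeta> - z)) \<partial>M)"
    using i1 i2 by (simp only: Bochner_Integration.integral_add integrable_mult_right integrable_of_real
        integral_of_real integral_mult_right_zero)
  finally show ?thesis .
qed

lemma wherglotz_holomorphic:
  assumes w: "w \<in> borel_measurable borel" "\<And>\<zeta>. norm \<zeta> = 1 \<Longrightarrow> \<bar>w \<zeta>\<bar> \<le> C"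
  shows "wherglotz w holomorphic_on ball 0 1"
proof -
  have "(\<lambda>z. of_real (\<integral>\<zeta>. w \<zeta> \<partial>M) + 2 * z * (\<integral>\<zeta>. of_real (w \<zeta>) * (1 / (\<zeta> - z)) \<partial>M)) holomorphic_on ball 0 1"
    by (intro holomorphic_intros cauchy_transform_holomorphic[OF w])
  then show ?thesis
    by (rule holomorphic_transform) (use wherglotz_eq[OF w] in auto)
qed

text \<open>By the product rule the derivative of \<open>z * G z\<close> at 0 is \<open>G 0\<close>,
  and \<open>1 / \<zeta>\<close> is \<open>cnj \<zeta>\<close> on the circle. This is how the
  balance condition corresponds to a vanishing derivative.\<close>

lemma deriv_wherglotz_0:
  assumes w: "w \<in> borel_measurable borel" "\<And>\<zeta>. norm \<zeta> = 1 \<Longrightarrow> \<bar>w \<zeta>\<bar> \<le> C"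
  shows "(wherglotz w has_field_derivative 2 * (\<integral>\<zeta>. of_real (w \<zeta>) * cnj \<zeta> \<partial>M)) (at 0)"
proof -
  define G where "G z = (\<integral>\<zeta>. of_real (w \<zeta>) * (1 / (\<zeta> - z)) \<partial>M)" for z
  have "G holomorphic_on ball 0 1"
    unfolding G_def by (rule cauchy_transform_holomorphic[OF w])
  then have G': "(G has_field_derivative deriv G 0) (at 0)"
    by (rule holomorphic_derivI) auto
  have "((\<lambda>z. of_real (\<integral>\<zeta>. w \<zeta> \<partial>M) + 2 * z * G z) has_field_derivative 2 * G 0) (at 0)"
    by (rule derivative_eq_intros G' refl | simp)+
  also have "G 0 = (\<integral>\<zeta>. of_real (w \<zeta>) * cnj \<zeta> \<partial>M)"
    unfolding G_def
  proof (rule Bochner_Integration.integral_cong[OF refl])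
    fix \<zeta> assume "\<zeta> \<in> space M"
    then have "norm \<zeta> = 1" by (rule norm_eq_1)
    then have "1 / \<zeta> = cnj \<zeta>" by (simp add: complex_div_cnj[of 1])
    then show "of_real (w \<zeta>) * (1 / (\<zeta> - 0)) = of_real (w \<zeta>) * cnj \<zeta>" by simp
  qed
  finally have "((\<lambda>z. of_real (\<integral>\<zeta>. w \<zeta> \<partial>M) + 2 * z * G z) has_field_derivative
      2 * (\<integral>\<zeta>. of_real (w \<zeta>) * cnj \<zeta> \<partial>M)) (at 0)" .
  then show ?thesis
    by (rule has_field_derivative_transform_within_open[of _ _ _ "ball 0 1"])
       (use wherglotz_eq[OF w] in \<open>auto simp: G_def\<close>)
qed

lemma Re_wherglotz:
  assumes w: "w \<in> borel_measurable borel" "\<And>\<zeta>. norm \<zeta> = 1 \<Longrightarrow> \<bar>w \<zeta>\<bar> \<le> C" and z: "norm z < 1"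
  shows "integrable M (\<lambda>\<zeta>. w \<zeta> * ((1 - norm z ^ 2) / norm (\<zeta> - z) ^ 2))"
    "Re (wherglotz w z) = (\<integral>\<zeta>. w \<zeta> * ((1 - norm z ^ 2) / norm (\<zeta> - z) ^ 2) \<partial>M)"
proof -
  have eq: "Re (of_real (w \<zeta>) * ((\<zeta> + z) / (\<zeta> - z))) = w \<zeta> * ((1 - norm z ^ 2) / norm (\<zeta> - z) ^ 2)"
    if "\<zeta> \<in> space M" for \<zeta>
  proof -
    have "norm \<zeta> = 1" "\<zeta> \<noteq> z" using that z norm_eq_1 by force+
    then show ?thesis by (simp add: Re_herglotz_kernel flip: times_divide_eq_right)
  qed
  have int: "integrable M (\<lambda>\<zeta>. of_real (w \<zeta>) * ((\<zeta> + z) / (\<zeta> - z)))"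
    by (rule integrable_wherglotz[OF w z])
  show "integrable M (\<lambda>\<zeta>. w \<zeta> * ((1 - norm z ^ 2) / norm (\<zeta> - z) ^ 2))"
    using integrable_Re[OF int] by (subst (asm) Bochner_Integration.integrable_cong[OF refl eq]) auto
  have "Re (wherglotz w z) = (\<integral>\<zeta>. Re (of_real (w \<zeta>) * ((\<zeta> + z) / (\<zeta> - z))) \<partial>M)"
    unfolding wherglotz_def by (rule integral_Re[OF int, symmetric])
  also have "\<dots> = (\<integral>\<zeta>. w \<zeta> * ((1 - norm z ^ 2) / norm (\<zeta> - z) ^ 2) \<partial>M)"
    by (rule Bochner_Integration.integral_cong[OF refl eq])
  finally show "Re (wherglotz w z) = (\<integral>\<zeta>. w \<zeta> * ((1 - norm z ^ 2) / norm (\<zeta> - z) ^ 2) \<partial>M)" .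
qed

lemma wherglotz_in_pos_disk:
  assumes w: "w \<in> borel_measurable borel" "\<And>\<zeta>. norm \<zeta> = 1 \<Longrightarrow> \<bar>w \<zeta>\<bar> \<le> C"
    and nonneg: "\<And>\<zeta>. norm \<zeta> = 1 \<Longrightarrow> 0 \<le> w \<zeta>"
    and mass: "(\<integral>\<zeta>. w \<zeta> \<partial>M) = 1" and bal: "(\<integral>\<zeta>. of_real (w \<zeta>) * cnj \<zeta> \<partial>M) = 0"
  shows "(\<lambda>z. if z \<in> ball 0 1 then wherglotz w z else 0) \<in> pos_disk" (is "?f \<in> _")
proof -
  have holo: "?f holomorphic_on ball 0 1"
    using wherglotz_holomorphic[OF w] by (rule holomorphic_transform) auto
  have "(?f has_field_derivative 2 * (\<integral>\<zeta>. of_real (w \<zeta>) * cnj \<zeta> \<partial>M)) (at 0)"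
    using deriv_wherglotz_0[OF w]
    by (rule has_field_derivative_transform_within_open[of _ _ _ "ball 0 1"]) auto
  then have d: "deriv ?f 0 = 0" using bal by (simp add: DERIV_imp_deriv)
  have one: "wherglotz w 0 = 1"
    using wherglotz_eq[OF w, of 0] mass by simp
  have pos: "Re (wherglotz w z) > 0" if "z \<in> ball 0 1" for z
  proof -
    have z: "norm z < 1" using that by simp
    \<comment> \<open>A lower bound for the Poisson kernel at \<open>z\<close>, from
      \<open>norm (\<zeta> - z) \<le> 2\<close>. Integrated against mass 1 it makes the positivity
      strict.\<close>
    define c where "c = (1 - norm z ^ 2) / 4"
    have "norm z ^ 2 < 1" using z by (simp add: abs_square_less_1)
    then have c: "c > 0" by (simp add: c_def)
    have "(\<integral>\<zeta>. w \<zeta> * c \<partial>M) \<le> (\<integral>\<zeta>. w \<zeta> * ((1 - norm z ^ 2) / norm (\<zeta> - z) ^ 2) \<partial>M)"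
    proof (rule integral_mono)
      show "integrable M (\<lambda>\<zeta>. w \<zeta> * c)" using w by (intro integrable_mult_left integrable_boundedI[of _ C]) auto
      show "integrable M (\<lambda>\<zeta>. w \<zeta> * ((1 - norm z ^ 2) / norm (\<zeta> - z) ^ 2))"
        by (rule Re_wherglotz[OF w z])
      fix \<zeta> assume "\<zeta> \<in> space M"
      then have \<zeta>: "norm \<zeta> = 1" by (rule norm_eq_1)
      have "norm (\<zeta> - z) \<le> 2" using \<zeta> z norm_triangle_ineq4[of \<zeta> z] by simp
      then have "norm (\<zeta> - z) ^ 2 \<le> 2 ^ 2" by (intro power_mono) auto
      moreover have "norm (\<zeta> - z) > 0" using \<zeta> z by auto
      ultimately have "c \<le> (1 - norm z ^ 2) / norm (\<zeta> - z) ^ 2"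
        unfolding c_def using \<open>norm z ^ 2 < 1\<close> by (intro divide_left_mono) auto
      then show "w \<zeta> * c \<le> w \<zeta> * ((1 - norm z ^ 2) / norm (\<zeta> - z) ^ 2)"
        using nonneg[OF \<zeta>] by (rule mult_left_mono)
    qed
    then have "c \<le> Re (wherglotz w z)" using mass Re_wherglotz(2)[OF w z] by simp
    then show ?thesis using c by simp
  qed
  show ?thesis using holo d one pos by (auto simp: pos_disk_def)
qed

end

section \<open>Herglotz integrals of balanced probability measures\<close>

lemma circle_measure_circle_measures: "\<mu> \<in> circle_measures \<Longrightarrow> circle_measure \<mu>"
  by (auto simp: circle_measures_def circle_measure_def circle_measure_axioms_def prob_space.finite_measure)

lemma herglotz_eq_wherglotz:
  "\<mu> \<in> circle_measures \<Longrightarrow>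
    herglotz \<mu> = (\<lambda>z. if z \<in> ball 0 1 then circle_measure.wherglotz \<mu> (\<lambda>_. 1) z else 0)"
  using circle_measure.wherglotz_def[OF circle_measure_circle_measures]
  by (auto simp: herglotz_def fun_eq_iff)

lemma herglotz_in_pos_disk:
  assumes "\<mu> \<in> circle_measures"
  shows "herglotz \<mu> \<in> pos_disk"
proof -
  interpret circle_measure \<mu> using assms by (rule circle_measure_circle_measures)
  interpret prob_space \<mu> using assms by (simp add: circle_measures_def)
  show ?thesis
    unfolding herglotz_eq_wherglotz[OF assms]
    by (rule wherglotz_in_pos_disk[where C = 1])
      (use assms prob_space in \<open>auto simp: circle_measures_def\<close>)
qed

section \<open>The Herglotz representation\<close>

text \<open>Averages over the circle are written as integrals along \<open>circlepath 0 1 t = exp (2 * pi * \<i> * t)\<close>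
  over \<open>{0..1}\<close>, so that no factor \<open>1 / (2 * pi)\<close> appears.\<close>

lemma norm_circlepath_0_1 [simp]: "norm (circlepath 0 1 t) = 1"
  by (simp add: circlepath norm_exp_eq_Re)

lemma Cauchy_formula_circle_average:
  assumes "f holomorphic_on cball 0 1" "norm z < 1"
  shows "((\<lambda>t. f (circlepath 0 1 t) * (circlepath 0 1 t / (circlepath 0 1 t - z))) has_integral f z) {0..1}"
proof -
  have "((\<lambda>u. f u / (u - z)) has_contour_integral (2 * of_real pi * \<i> * f z)) (circlepath 0 1)"
    using assms by (intro Cauchy_integral_circlepath_simple) auto
  then have "((\<lambda>t. f (circlepath 0 1 t) / (circlepath 0 1 t - z) *
      vector_derivative (circlepath 0 1) (at t within {0..1})) has_integral (2 * of_real pi * \<i> * f z)) {0..1}"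
    by (simp add: has_contour_integral_def)
  then have "((\<lambda>t. 1 / (2 * of_real pi * \<i>) * (f (circlepath 0 1 t) / (circlepath 0 1 t - z) *
      vector_derivative (circlepath 0 1) (at t within {0..1}))) has_integral
      1 / (2 * of_real pi * \<i>) * (2 * of_real pi * \<i> * f z)) {0..1}"
    by (rule has_integral_mult_right)
  moreover have "1 / (2 * of_real pi * \<i>) * (f (circlepath 0 1 t) / (circlepath 0 1 t - z) *
      vector_derivative (circlepath 0 1) (at t within {0..1})) =
      f (circlepath 0 1 t) * (circlepath 0 1 t / (circlepath 0 1 t - z))" if "t \<in> {0..1}" for t
  proof -
    have vd: "vector_derivative (circlepath 0 1) (at t within {0..1}) = 2 * of_real pi * \<i> * circlepath 0 1 t"
      using that by (subst vector_derivative_circlepath01) (simp_all add: circlepath)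
    have cancel: "1 / K * (a / b * (K * c)) = a * (c / b)" if "K \<noteq> 0" for K a b c :: complex
      using that by simp
    show ?thesis unfolding vd by (rule cancel) simp
  qed
  ultimately show ?thesis
    by (subst (asm) has_integral_cong) auto
qed

lemma mean_value_circle_average:
  assumes "f holomorphic_on cball 0 1"
  shows "((\<lambda>t. f (circlepath 0 1 t)) has_integral f 0) {0..1}"
proof -
  have nz: "circlepath 0 1 t \<noteq> 0" for t using norm_circlepath_0_1[of t] by (metis norm_zero zero_neq_one)
  show ?thesis using Cauchy_formula_circle_average[OF assms, of 0] nz by simp
qed

text \<open>Write \<open>Re f\<close> as half of \<open>f\<close> plus its conjugate. The
  \<open>f\<close> half is Cauchy's formula taken twice minus the mean value; the conjugate half is
  the mean value of the conjugate of a holomorphic function. The sum is \<open>f z\<close> up to the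
  imaginary part of \<open>f 0\<close>, which is zero.\<close>

lemma Schwarz_integral_formula:
  assumes f: "f holomorphic_on cball 0 1" and z: "norm z < 1" and f0: "Im (f 0) = 0"
  shows "((\<lambda>t. of_real (Re (f (circlepath 0 1 t))) * ((circlepath 0 1 t + z) / (circlepath 0 1 t - z)))
    has_integral f z) {0..1}"
proof -
  let ?e = "circlepath 0 1"
  have ne: "?e t \<noteq> z" for t using norm_circlepath_0_1[of t] z by force
  have "((\<lambda>t. 2 * (f (?e t) * (?e t / (?e t - z))) - f (?e t)) has_integral 2 * f z - f 0) {0..1}"
    by (intro has_integral_diff has_integral_mult_right Cauchy_formula_circle_average mean_value_circle_average f z)
  also have "(\<lambda>t. 2 * (f (?e t) * (?e t / (?e t - z))) - f (?e t)) = (\<lambda>t. f (?e t) * ((?e t + z) / (?e t - z)))"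
    using ne by (auto simp: fun_eq_iff divide_simps) (simp add: algebra_simps)
  finally have 1: "((\<lambda>t. f (?e t) * ((?e t + z) / (?e t - z))) has_integral 2 * f z - f 0) {0..1}" .
  \<comment> \<open>On the circle, conjugation inverts \<open>u\<close>, so the conjugate of the
    second factor is the Herglotz kernel at \<open>z\<close>. Its pole lies outside the closed
    disk.\<close>
  define g where "g u = f u * ((1 + cnj z * u) / (1 - cnj z * u))" for u
  have nz: "1 - cnj z * u \<noteq> 0" if "norm u \<le> 1" for u
  proof
    assume "1 - cnj z * u = 0"
    then have "norm (cnj z * u) = 1" by simp
    moreover have "norm (cnj z * u) \<le> norm z * 1"
      unfolding norm_mult complex_mod_cnj using that by (intro mult_left_mono) auto
    ultimately show False using z by simp
  qed
  have "g holomorphic_on cball 0 1"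
    unfolding g_def using nz by (intro holomorphic_intros f) auto
  then have "((\<lambda>t. g (?e t)) has_integral g 0) {0..1}"
    by (rule mean_value_circle_average)
  then have "((\<lambda>t. cnj (g (?e t))) has_integral cnj (g 0)) {0..1}"
    by (subst (asm) has_integral_cnj[symmetric]) (simp add: o_def)
  also have "(\<lambda>t. cnj (g (?e t))) = (\<lambda>t. cnj (f (?e t)) * ((?e t + z) / (?e t - z)))"
  proof
    fix t
    have c: "?e t * cnj (?e t) = 1"
      by (simp add: complex_norm_square[symmetric])
    have "(1 + z * cnj (?e t)) * (?e t - z) = (?e t + z) * (1 - z * cnj (?e t))"
      using c by algebra
    moreover have "1 - z * cnj (?e t) \<noteq> 0"
      using nz[of "?e t"]
        by (metis complex_cnj_cnj complex_cnj_diff complex_cnj_mult complex_cnj_one complex_cnj_zero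
            norm_circlepath_0_1 order_refl)
    ultimately have "(1 + z * cnj (?e t)) / (1 - z * cnj (?e t)) = (?e t + z) / (?e t - z)"
      using ne[of t] by (simp add: frac_eq_eq)
    then show "cnj (g (?e t)) = cnj (f (?e t)) * ((?e t + z) / (?e t - z))"
      by (simp add: g_def flip: times_divide_eq_right)
  qed
  finally have "((\<lambda>t. cnj (f (?e t)) * ((?e t + z) / (?e t - z))) has_integral cnj (f 0)) {0..1}"
    by (simp add: g_def)
  from has_integral_mult_right[OF has_integral_add[OF 1 this], of "1 / 2"]
  have "((\<lambda>t. 1 / 2 * (f (?e t) * ((?e t + z) / (?e t - z)) + cnj (f (?e t)) * ((?e t + z) / (?e t - z))))
      has_integral 1 / 2 * (2 * f z - f 0 + cnj (f 0))) {0..1}" .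
  also have "cnj (f 0) = f 0" using f0 by (simp add: complex_eq_iff)
  also have "1 / 2 * (2 * f z - f 0 + f 0) = f z" by simp
  also have "(\<lambda>t. 1 / 2 * (f (?e t) * ((?e t + z) / (?e t - z)) + cnj (f (?e t)) * ((?e t + z) / (?e t - z)))) =
      (\<lambda>t. of_real (Re (f (?e t))) * ((?e t + z) / (?e t - z)))"
    by (simp only: ring_distribs[symmetric] complex_add_cnj) simp
  finally show ?thesis .
qed

text \<open>Regards the density as a distribution on the whole line, the setting of tightness and
  weak convergence. The interval \<open>{-1<..1}\<close> has the half-open shape that
  \<open>tight\<close> asks for and contains \<open>{0..1}\<close>.\<close>

lemma circle_density_real_distribution:
  fixes d :: "real \<Rightarrow> real"
  assumes cont: "continuous_on UNIV d" and nonneg: "\<And>t. 0 \<le> d t" and int: "(d has_integral 1) {0..1}"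
  defines "\<mu> \<equiv> density lborel (\<lambda>t. ennreal (indicator {0..1} t * d t))"
  shows "real_distribution \<mu>" "measure \<mu> {-1<..1} = 1"
    "\<And>h :: real \<Rightarrow> complex. continuous_on UNIV h \<Longrightarrow> integral\<^sup>L \<mu> h = integral {0..1} (\<lambda>t. of_real (d t) * h t)"
proof -
  have [measurable]: "d \<in> borel_measurable borel" by (rule borel_measurable_continuous_onI[OF cont])
  have "set_integrable lborel {0..1} d"
    by (rule borel_integrable_atLeastAtMost') (rule continuous_on_subset[OF cont], simp)
  then have "integrable lborel (\<lambda>t. indicator {0..1} t * d t)" "(\<integral>t. indicator {0..1} t * d t \<partial>lborel) = 1"
    using set_borel_integral_eq_integral(2)[of "{0..1}" d] integral_unique[OF int]
    by (auto simp: set_integrable_def set_lebesgue_integral_def)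
  then have "(\<integral>\<^sup>+t. ennreal (indicator {0..1} t * d t) \<partial>lborel) = 1"
    using nonneg by (subst nn_integral_eq_integral) auto
  then have "emeasure \<mu> (space \<mu>) = 1"
    by (simp add: \<mu>_def emeasure_density)
  then have p: "prob_space \<mu>" by (rule prob_spaceI)
  then show "real_distribution \<mu>"
    by (simp add: real_distribution_def real_distribution_axioms_def \<mu>_def)
  interpret prob_space \<mu> by fact
  have "AE t in \<mu>. t \<in> {-1<..1}"
    unfolding \<mu>_def by (subst AE_density) (auto simp: indicator_def)
  then show "measure \<mu> {-1<..1} = 1"
    by (subst prob_eq_1) (auto simp: \<mu>_def)
  fix h :: "real \<Rightarrow> complex" assume h: "continuous_on UNIV h"
  have [measurable]: "h \<in> borel_measurable borel" by (rule borel_measurable_continuous_onI[OF h])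
  have "integral\<^sup>L \<mu> h = (\<integral>t. (indicator {0..1} t * d t) *\<^sub>R h t \<partial>lborel)"
    unfolding \<mu>_def using nonneg by (subst integral_density) auto
  also have "\<dots> = (LINT t : {0..1} | lborel. of_real (d t) * h t)"
    unfolding set_lebesgue_integral_def
    by (intro Bochner_Integration.integral_cong refl) (simp add: scaleR_conv_of_real)
  also have "\<dots> = integral {0..1} (\<lambda>t. of_real (d t) * h t)"
    by (intro set_borel_integral_eq_integral(2) borel_integrable_atLeastAtMost' continuous_intros
        continuous_on_subset[OF cont] continuous_on_subset[OF h]) auto
  finally show "integral\<^sup>L \<mu> h = integral {0..1} (\<lambda>t. of_real (d t) * h t)" .
qed

text \<open>The measure is a weak limit, along a subsequence, of the measures with densities \<open>Re \<phi>\<close> on the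
  circles of radius \<open>r n < 1\<close>; Helly's theorem is applied on the interval parametrizing the circle.\<close>

lemma herglotz_representation:
  assumes \<phi>: "\<phi> \<in> pos_disk"
  shows "\<exists>\<mu>\<in>circle_measures. \<phi> = herglotz \<mu>"
proof -
  have holo: "\<phi> holomorphic_on ball 0 1" and pos: "\<And>z. norm z < 1 \<Longrightarrow> Re (\<phi> z) > 0"
    and \<phi>0: "\<phi> 0 = 1" "deriv \<phi> 0 = 0" and out: "\<And>z. \<not> norm z < 1 \<Longrightarrow> \<phi> z = 0"
    using \<phi> by (auto simp: pos_disk_def)
  let ?e = "circlepath 0 1"
  have e_cont: "continuous_on A ?e" for A unfolding circlepath by (intro continuous_intros)
  \<comment> \<open>Radii strictly below 1 keep the dilates \<open>f n\<close> holomorphic on the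
    closed disk; letting them tend to 1 recovers \<open>\<phi>\<close>.\<close>
  define r where "r n = 1 - 1 / real (Suc n)" for n
  have r: "0 \<le> r n" "r n < 1" for n by (auto simp: r_def field_simps)
  have rlim: "r \<longlonglongrightarrow> 1"
    unfolding r_def using tendsto_diff[OF tendsto_const LIMSEQ_inverse_real_of_nat, of 1]
    by (simp add: inverse_eq_divide)
  define f where "f n z = \<phi> (of_real (r n) * z)" for n z
  have rz: "norm (of_real (r n) * z) < 1" if "norm z \<le> 1" for n and z :: complex
  proof -
    have "r n * norm z \<le> r n * 1" using r that by (intro mult_left_mono) auto
    then show ?thesis using r[of n] by (simp add: norm_mult)
  qed
  have f_holo: "f n holomorphic_on cball 0 1" for n
    unfolding f_def
    by (rule holomorphic_on_compose_gen[OF _ holo, unfolded o_def]) (use rz in \<open>auto intro!: holomorphic_intros\<close>)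
  have f0: "f n 0 = 1" for n by (simp add: f_def \<phi>0)
  define d where "d n t = Re (f n (?e t))" for n t
  have d_cont: "continuous_on UNIV (d n)" for n
    unfolding d_def
    by (intro continuous_intros continuous_on_compose2[OF holomorphic_on_imp_continuous_on[OF f_holo] e_cont]) auto
  have d_nonneg: "0 \<le> d n t" for n t
    using pos[OF rz[of "?e t" n]] by (simp add: d_def f_def)
  have d_int: "(d n has_integral 1) {0..1}" for n
    using has_integral_Re[OF mean_value_circle_average[OF f_holo[of n]]] f0 by (simp add: d_def[abs_def])
  define \<mu> where "\<mu> n = density lborel (\<lambda>t. ennreal (indicator {0..1} t * d n t))" for n
  note \<mu> = circle_density_real_distribution[OF d_cont d_nonneg d_int, folded \<mu>_def]
  have "tight \<mu>"
    unfolding tight_def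
  proof (intro conjI allI impI)
    fix \<epsilon> :: real assume "\<epsilon> > 0"
    then show "\<exists>a b. a < b \<and> (\<forall>n. 1 - \<epsilon> < measure (\<mu> n) {a<..b})"
      by (intro exI[of _ "-1"] exI[of _ 1]) (simp add: \<mu>)
  qed (rule \<mu>)
  then obtain s M where s: "strict_mono (s :: nat \<Rightarrow> nat)" and M: "real_distribution M"
    and conv: "weak_conv_m (\<mu> \<circ> id \<circ> s) M"
    using tight_imp_convergent_subsubsequence[of \<mu> id] strict_mono_id by blast
  interpret M: real_distribution M by fact
  have [measurable]: "?e \<in> measurable M (restrict_space borel (sphere 0 1))"
    by (intro measurable_restrict_space2) (auto intro!: M.measurable_finite_borel borel_measurable_continuous_onI e_cont)
  define \<nu> where "\<nu> = distr M (restrict_space borel (sphere 0 1)) ?e"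
  have prob: "prob_space \<nu>" unfolding \<nu>_def by (rule M.prob_space_distr) measurable
  have sets: "sets \<nu> = sets (restrict_space borel (sphere 0 1))" by (simp add: \<nu>_def)
  have eq: "\<phi> z = herglotz \<nu> z" for z
  proof (cases "norm z < 1")
    case z: True
    define h where "h t = (?e t + z) / (?e t - z)" for t
    have ne: "?e t - z \<noteq> 0" for t using norm_circlepath_0_1[of t] z by force
    have h_cont: "continuous_on UNIV h" unfolding h_def using ne by (intro continuous_intros e_cont) auto
    have h_bound: "norm (h t) \<le> 2 / (1 - norm z)" for t
      unfolding h_def by (rule norm_herglotz_kernel_le) (use z in auto)
    \<comment> \<open>For fixed \<open>z\<close> in the disk the kernel is bounded and continuous in
      the parameter, so it is an admissible test function for weak convergence. Its integrals are
      the values of the dilates at \<open>z\<close>.\<close>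
    have "(\<lambda>n. integral\<^sup>L ((\<mu> \<circ> id \<circ> s) n) h) \<longlonglongrightarrow> integral\<^sup>L M h"
      by (rule weak_conv_imp_integral_bdd_continuous_conv[OF _ M conv _ h_bound])
         (use \<mu>(1) h_cont in \<open>auto simp: continuous_on_eq_continuous_at\<close>)
    also have "(\<lambda>n. integral\<^sup>L ((\<mu> \<circ> id \<circ> s) n) h) = (\<lambda>n. f (s n) z)"
    proof
      fix n
      have "((\<lambda>t. of_real (d (s n) t) * h t) has_integral f (s n) z) {0..1}"
        unfolding d_def h_def by (rule Schwarz_integral_formula[OF f_holo z]) (simp add: f0)
      then show "integral\<^sup>L ((\<mu> \<circ> id \<circ> s) n) h = f (s n) z"
        using \<mu>(3)[OF h_cont, of "s n"] by (simp add: integral_unique)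
    qed
    finally have lim1: "(\<lambda>n. f (s n) z) \<longlonglongrightarrow> integral\<^sup>L M h" .
    have "isCont \<phi> z"
      using holomorphic_on_imp_continuous_on[OF holo] z by (simp add: continuous_on_eq_continuous_at)
    moreover have "(\<lambda>n. of_real (r (s n)) * z) \<longlonglongrightarrow> of_real 1 * z"
      by (intro tendsto_intros LIMSEQ_subseq_LIMSEQ[OF rlim s, unfolded o_def])
    ultimately have "(\<lambda>n. f (s n) z) \<longlonglongrightarrow> \<phi> z"
      unfolding f_def using isCont_tendsto_compose[of z \<phi> "\<lambda>n. of_real (r (s n)) * z" sequentially] by simp
    then have "\<phi> z = integral\<^sup>L M h" using lim1 by (rule LIMSEQ_unique)
    also have "\<dots> = (\<integral>\<zeta>. (\<zeta> + z) / (\<zeta> - z) \<partial>\<nu>)"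
      unfolding \<nu>_def h_def by (subst integral_distr) (auto intro!: measurable_restrict_space1)
    finally show ?thesis using z by (simp add: herglotz_def)
  qed (simp add: herglotz_def out)
  interpret \<nu>: circle_measure \<nu>
    using prob sets by (simp add: circle_measure_def circle_measure_axioms_def prob_space.finite_measure)
  \<comment> \<open>Balance is read off the finished representation: \<open>deriv \<phi> 0\<close>
    is twice the integral of \<open>cnj\<close>.\<close>
  have "(\<nu>.wherglotz (\<lambda>_. 1) has_field_derivative 2 * (\<integral>\<zeta>. of_real 1 * cnj \<zeta> \<partial>\<nu>)) (at 0)"
    by (rule \<nu>.deriv_wherglotz_0[of _ 1]) auto
  then have "(\<phi> has_field_derivative 2 * (\<integral>\<zeta>. of_real 1 * cnj \<zeta> \<partial>\<nu>)) (at 0)"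
    by (rule has_field_derivative_transform_within_open[of _ _ _ "ball 0 1"])
       (auto simp: eq herglotz_def \<nu>.wherglotz_def)
  then have "2 * (\<integral>\<zeta>. of_real 1 * cnj \<zeta> \<partial>\<nu>) = 0" using \<phi>0(2) DERIV_imp_deriv by metis
  then have "(\<integral>\<zeta>. cnj \<zeta> \<partial>\<nu>) = 0" by (simp only: of_real_1 mult_1 mult_eq_0_iff) simp
  then have "\<nu> \<in> circle_measures" using prob sets by (simp only: circle_measures_def mem_Collect_eq)
  then show ?thesis using eq by blast
qed

section \<open>Atoms and extreme points\<close>

context circle_measure
begin

lemma singleton_in_sets: "norm s = 1 \<Longrightarrow> {s} \<in> sets M"
  using Int_sphere_in_sets[of "{s}"] by simp

text \<open>The kernel at \<open>r s\<close> is at most \<open>2 / (1 - r)\<close> in norm, so the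
  scaled integrand is dominated by 1. At \<open>\<zeta> = s\<close> it equals
  \<open>(1 + r) / 2\<close> and tends to 1; at every other point of the circle the kernel stays
  finite and the limit is 0.\<close>

lemma wherglotz_radial_limit:
  fixes s :: complex
  assumes s: "norm s = 1"
  defines "r \<equiv> \<lambda>n. 1 - 1 / real (Suc n)"
  shows "(\<lambda>n. of_real ((1 - r n) / 2) * wherglotz (\<lambda>_. 1) (of_real (r n) * s)) \<longlonglongrightarrow> of_real (measure M {s})"
proof -
  have r: "0 \<le> r n" "r n < 1" for n by (auto simp: r_def field_simps)
  have rlim: "r \<longlonglongrightarrow> 1"
    unfolding r_def using tendsto_diff[OF tendsto_const LIMSEQ_inverse_real_of_nat, of 1]
    by (simp add: inverse_eq_divide)
  define f where "f n \<zeta> = of_real ((1 - r n) / 2) * ((\<zeta> + of_real (r n) * s) / (\<zeta> - of_real (r n) * s))" for n \<zeta>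
  have "(\<lambda>n. \<integral>\<zeta>. f n \<zeta> \<partial>M) \<longlonglongrightarrow> (\<integral>\<zeta>. of_real (indicator {s} \<zeta>) \<partial>M)"
  proof (rule integral_dominated_convergence)
    show "f n \<in> borel_measurable M" for n unfolding f_def by measurable
    show "(\<lambda>\<zeta>. complex_of_real (indicator {s} \<zeta>)) \<in> borel_measurable M" by measurable
    show "integrable M (\<lambda>_. 1 :: real)" by simp
    show "AE \<zeta> in M. norm (f n \<zeta>) \<le> 1" for n
    proof (rule AE_I2)
      fix \<zeta> assume "\<zeta> \<in> space M"
      then have \<zeta>: "norm \<zeta> = 1" by (rule norm_eq_1)
      have n: "norm (of_real (r n) * s) = r n" using r[of n] s by (simp add: norm_mult)
      have "norm (f n \<zeta>) = (1 - r n) / 2 * norm ((\<zeta> + of_real (r n) * s) / (\<zeta> - of_real (r n) * s))"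
        unfolding f_def norm_mult[of "of_real _"] norm_of_real using r[of n] by simp
      also have "\<dots> \<le> (1 - r n) / 2 * (2 / (1 - r n))"
        using norm_herglotz_kernel_le[OF \<zeta>, of "of_real (r n) * s"] n r[of n] by (intro mult_left_mono) auto
      also have "\<dots> = 1" using r(2)[of n] by simp
      finally show "norm (f n \<zeta>) \<le> 1" .
    qed
    show "AE \<zeta> in M. (\<lambda>n. f n \<zeta>) \<longlonglongrightarrow> of_real (indicator {s} \<zeta>)"
    proof (rule AE_I2)
      fix \<zeta> assume "\<zeta> \<in> space M"
      show "(\<lambda>n. f n \<zeta>) \<longlonglongrightarrow> of_real (indicator {s} \<zeta>)"
      proof (cases "\<zeta> = s")
        case True
        have feq: "(\<lambda>n. f n \<zeta>) = (\<lambda>n. of_real ((1 + r n) / 2))"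
        proof
          fix n
          have "s \<noteq> 0" using s by auto
          have "\<zeta> + of_real (r n) * s = of_real (1 + r n) * s" "\<zeta> - of_real (r n) * s = of_real (1 - r n) * s"
            using True by (simp_all add: algebra_simps)
          then show "f n \<zeta> = of_real ((1 + r n) / 2)"
            using r(2)[of n] \<open>s \<noteq> 0\<close> unfolding f_def by (simp flip: of_real_diff of_real_add)
        qed
        have "(\<lambda>n. complex_of_real ((1 + r n) / 2)) \<longlonglongrightarrow> of_real ((1 + 1) / 2)"
          by (intro tendsto_intros rlim) auto
        then show ?thesis unfolding feq using True by simp
      next
        case False
        have "(\<lambda>n. f n \<zeta>) \<longlonglongrightarrow> of_real ((1 - 1) / 2) * ((\<zeta> + of_real 1 * s) / (\<zeta> - of_real 1 * s))"
          unfolding f_def using False by (intro tendsto_intros rlim) auto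
        then show ?thesis using False by simp
      qed
    qed
  qed
  also have "(\<integral>\<zeta>. complex_of_real (indicator {s} \<zeta>) \<partial>M) = of_real (measure M {s})"
    using singleton_in_sets[OF s] by (simp add: space_M s)
  also have "(\<lambda>n. \<integral>\<zeta>. f n \<zeta> \<partial>M) = (\<lambda>n. of_real ((1 - r n) / 2) * wherglotz (\<lambda>_. 1) (of_real (r n) * s))"
    unfolding f_def wherglotz_def by (subst integral_mult_right_zero) simp
  finally show ?thesis .
qed

lemma integral_finite_support:
  fixes f :: "complex \<Rightarrow> 'b::{banach, second_countable_topology}"
  assumes S: "finite S" "S \<subseteq> space M" and null: "emeasure M (space M - S) = 0"
    and f: "f \<in> borel_measurable borel"
  shows "(\<integral>\<zeta>. f \<zeta> \<partial>M) = (\<Sum>s\<in>S. measure M {s} *\<^sub>R f s)"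
proof -
  have sing: "{s} \<in> sets M" if "s \<in> S" for s
    using S that norm_eq_1 by (intro singleton_in_sets) auto
  have "S \<in> sets M"
    using sets.finite_UN[OF S(1), of "\<lambda>s. {s}" M] sing by simp
  then have "AE \<zeta> in M. \<zeta> \<in> S"
    using null by (intro AE_I[of _ _ "space M - S"]) auto
  then have "AE \<zeta> in M. f \<zeta> = (\<Sum>s\<in>S. indicat_real {s} \<zeta> *\<^sub>R f s)"
  proof eventually_elim
    case (elim \<zeta>)
    have "(\<Sum>s\<in>S. indicat_real {s} \<zeta> *\<^sub>R f s) = (\<Sum>s\<in>S. if s = \<zeta> then f \<zeta> else 0)"
      by (intro sum.cong) (auto simp: indicator_def)
    then show ?case using elim S by simp
  qed
  then have "(\<integral>\<zeta>. f \<zeta> \<partial>M) = (\<integral>\<zeta>. (\<Sum>s\<in>S. indicat_real {s} \<zeta> *\<^sub>R f s) \<partial>M)"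
    by (intro integral_cong_AE measurable_M f) measurable
  also have "\<dots> = (\<Sum>s\<in>S. \<integral>\<zeta>. indicat_real {s} \<zeta> *\<^sub>R f s \<partial>M)"
    by (rule Bochner_Integration.integral_sum) (use sing in \<open>auto simp: less_top[symmetric]\<close>)
  also have "\<dots> = (\<Sum>s\<in>S. measure M {s} *\<^sub>R f s)"
  proof (rule sum.cong[OF refl])
    fix s assume s: "s \<in> S"
    then have "{s} \<inter> space M = {s}" using S by auto
    then show "(\<integral>\<zeta>. indicat_real {s} \<zeta> *\<^sub>R f s \<partial>M) = measure M {s} *\<^sub>R f s"
      using sing[OF s] by (subst integral_scaleR_left) (auto simp: less_top[symmetric])
  qed
  finally show ?thesis .
qed

end

text \<open>The three measures are linked only through their Herglotz integrals; radial limits carry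
  the linear relation over to the mass of each point.\<close>

lemma herglotz_segment_atoms:
  assumes \<mu>: "\<mu> \<in> circle_measures" "\<nu>1 \<in> circle_measures" "\<nu>2 \<in> circle_measures"
    and eq: "herglotz \<mu> = (1 - t) *\<^sub>R herglotz \<nu>1 + t *\<^sub>R herglotz \<nu>2" and s: "norm s = 1"
  shows "measure \<mu> {s} = (1 - t) * measure \<nu>1 {s} + t * measure \<nu>2 {s}"
proof -
  define r where "r n = 1 - 1 / real (Suc n)" for n
  have r: "0 \<le> r n" "r n < 1" for n by (auto simp: r_def field_simps)
  have b: "of_real (r n) * s \<in> ball 0 1" for n using r[of n] s by (simp add: norm_mult)
  have lim: "(\<lambda>n. of_real ((1 - r n) / 2) * herglotz \<nu> (of_real (r n) * s)) \<longlonglongrightarrow> of_real (measure \<nu> {s})"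
    if "\<nu> \<in> circle_measures" for \<nu>
    using circle_measure.wherglotz_radial_limit[OF circle_measure_circle_measures[OF that] s] b
    unfolding herglotz_eq_wherglotz[OF that] r_def by simp
  have "(\<lambda>n. of_real (1 - t) * (of_real ((1 - r n) / 2) * herglotz \<nu>1 (of_real (r n) * s)) +
      of_real t * (of_real ((1 - r n) / 2) * herglotz \<nu>2 (of_real (r n) * s)))
      \<longlonglongrightarrow> of_real (1 - t) * of_real (measure \<nu>1 {s}) + of_real t * of_real (measure \<nu>2 {s})"
    by (intro tendsto_intros lim \<mu>)
  also have "(\<lambda>n. of_real (1 - t) * (of_real ((1 - r n) / 2) * herglotz \<nu>1 (of_real (r n) * s)) +
      of_real t * (of_real ((1 - r n) / 2) * herglotz \<nu>2 (of_real (r n) * s)))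
      = (\<lambda>n. of_real ((1 - r n) / 2) * herglotz \<mu> (of_real (r n) * s))"
    unfolding eq plus_fun_apply scaleR_fun_apply scaleR_conv_of_real by (rule ext) algebra
  finally have "complex_of_real (measure \<mu> {s}) = of_real ((1 - t) * measure \<nu>1 {s} + t * measure \<nu>2 {s})"
    using lim[OF \<mu>(1)] by (simp add: LIMSEQ_unique)
  then show ?thesis by (simp only: of_real_eq_iff)
qed

lemma circle_measures_finite_support_sums:
  assumes \<nu>: "\<nu> \<in> circle_measures" and S: "finite S" "S \<subseteq> sphere 0 1" "emeasure \<nu> (space \<nu> - S) = 0"
  shows "(\<Sum>s\<in>S. measure \<nu> {s}) = 1" "(\<Sum>s\<in>S. measure \<nu> {s} *\<^sub>R s) = 0"
    "z \<in> ball 0 1 \<Longrightarrow> herglotz \<nu> z = (\<Sum>s\<in>S. measure \<nu> {s} *\<^sub>R ((s + z) / (s - z)))"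
proof -
  interpret circle_measure \<nu> by (rule circle_measure_circle_measures[OF \<nu>])
  interpret prob_space \<nu> using \<nu> by (simp add: circle_measures_def)
  have S': "S \<subseteq> space \<nu>" using S by (simp add: space_M)
  show "(\<Sum>s\<in>S. measure \<nu> {s}) = 1"
    using integral_finite_support[OF S(1) S' S(3), of "\<lambda>_. 1 :: real"] prob_space by simp
  have "cnj (\<Sum>s\<in>S. measure \<nu> {s} *\<^sub>R s) = (\<Sum>s\<in>S. measure \<nu> {s} *\<^sub>R cnj s)"
    by (simp add: scaleR_conv_of_real)
  also have "\<dots> = 0"
    using integral_finite_support[OF S(1) S' S(3), of cnj] \<nu>
    by (simp only: circle_measures_def mem_Collect_eq borel_measurable_continuous_onI continuous_on_cnj continuous_on_id)
  finally show "(\<Sum>s\<in>S. measure \<nu> {s} *\<^sub>R s) = 0" by (simp only: complex_cnj_zero_iff)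
  show "herglotz \<nu> z = (\<Sum>s\<in>S. measure \<nu> {s} *\<^sub>R ((s + z) / (s - z)))" if "z \<in> ball 0 1"
    using integral_finite_support[OF S(1) S' S(3), of "\<lambda>s. (s + z) / (s - z)"] that
    by (simp add: herglotz_def)
qed

lemma herglotz_extreme_point:
  assumes \<mu>: "\<mu> \<in> circle_measures" and atoms: "consists_of_atoms \<mu> S"
    and S: "finite S" "\<not> affine_dependent S"
  shows "herglotz \<mu> extreme_point_of pos_disk"
  unfolding extreme_point_of_def
proof (intro conjI ballI notI)
  show "herglotz \<mu> \<in> pos_disk" by (rule herglotz_in_pos_disk[OF \<mu>])
  fix \<phi>1 \<phi>2 assume "\<phi>1 \<in> pos_disk" "\<phi>2 \<in> pos_disk" and seg: "herglotz \<mu> \<in> open_segment \<phi>1 \<phi>2"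
  then obtain \<nu>1 \<nu>2 where \<nu>: "\<nu>1 \<in> circle_measures" "\<nu>2 \<in> circle_measures"
    and \<phi>: "\<phi>1 = herglotz \<nu>1" "\<phi>2 = herglotz \<nu>2"
    using herglotz_representation by metis
  obtain t where ne: "\<phi>1 \<noteq> \<phi>2" and t: "0 < t" "t < 1"
    and eq: "herglotz \<mu> = (1 - t) *\<^sub>R herglotz \<nu>1 + t *\<^sub>R herglotz \<nu>2"
    using seg \<phi> by (auto simp: in_segment)
  interpret M: circle_measure \<mu> by (rule circle_measure_circle_measures[OF \<mu>])
  have SS: "S \<subseteq> sphere 0 1" using atoms by (simp add: consists_of_atoms_def M.space_M)
  have null: "emeasure \<mu> (space \<mu> - S) = 0" using atoms by (simp add: consists_of_atoms_def)
  have meas: "(\<Sum>s\<in>S. measure \<nu> {s}) = measure \<nu> S \<and> measure \<nu> S \<le> 1 \<and> (measure \<nu> S = 1 \<longrightarrow> emeasure \<nu> (space \<nu> - S) = 0)"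
    if "\<nu> \<in> circle_measures" for \<nu>
  proof -
    interpret circle_measure \<nu> by (rule circle_measure_circle_measures[OF that])
    interpret prob_space \<nu> using that by (simp add: circle_measures_def)
    have sing: "{s} \<in> sets \<nu>" if "s \<in> S" for s
      using SS that by (intro singleton_in_sets) auto
    then have "S \<in> sets \<nu>"
      using sets.finite_UN[OF S(1), of "\<lambda>s. {s}" \<nu>] by simp
    moreover have "(\<Sum>s\<in>S. measure \<nu> {s}) = measure \<nu> S"
      using finite_measure_eq_sum_singleton[OF S(1)] sing by simp
    ultimately show ?thesis
      by (auto simp: prob_compl emeasure_eq_measure)
  qed
  have "(1 - t) * measure \<nu>1 S + t * measure \<nu>2 S = (\<Sum>s\<in>S. measure \<mu> {s})"
  proof -
    have "(\<Sum>s\<in>S. measure \<mu> {s}) = (\<Sum>s\<in>S. (1 - t) * measure \<nu>1 {s} + t * measure \<nu>2 {s})"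
      by (intro sum.cong refl herglotz_segment_atoms[OF \<mu> \<nu> eq]) (use SS in auto)
    then show ?thesis using meas \<nu> by (simp add: sum.distrib flip: sum_distrib_left)
  qed
  also have "\<dots> = 1" by (rule circle_measures_finite_support_sums[OF \<mu> S(1) SS null])
  \<comment> \<open>\<open>S\<close> has full \<open>\<mu>\<close>-mass, and that mass is a proper
    convex combination of two numbers at most 1. Both are therefore 1, so both end measures live on
    \<open>S\<close>.\<close>
  finally have one: "(1 - t) * (1 - measure \<nu>1 S) + t * (1 - measure \<nu>2 S) = 0"
    by (simp add: algebra_simps)
  have "0 \<le> 1 - measure \<nu>1 S" "0 \<le> 1 - measure \<nu>2 S" using meas \<nu> by auto
  then have "measure \<nu>1 S = 1" "measure \<nu>2 S = 1"
    using one t by (auto simp: add_nonneg_eq_0_iff)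
  then have null: "emeasure \<nu>1 (space \<nu>1 - S) = 0" "emeasure \<nu>2 (space \<nu>2 - S) = 0"
    using meas \<nu> by blast+
  note sums1 = circle_measures_finite_support_sums[OF \<nu>(1) S(1) SS null(1)]
  note sums2 = circle_measures_finite_support_sums[OF \<nu>(2) S(1) SS null(2)]
  \<comment> \<open>The differences of masses have total 0 and first moment 0; one nonzero
    difference would make them the coefficients of an affine dependence.\<close>
  have "measure \<nu>1 {s} = measure \<nu>2 {s}" if "s \<in> S" for s
  proof (rule ccontr)
    assume "measure \<nu>1 {s} \<noteq> measure \<nu>2 {s}"
    moreover have "(\<Sum>s\<in>S. measure \<nu>1 {s} - measure \<nu>2 {s}) = 0"
      using sums1(1) sums2(1) by (simp add: sum_subtractf)
    moreover have "(\<Sum>s\<in>S. (measure \<nu>1 {s} - measure \<nu>2 {s}) *\<^sub>R s) = 0"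
      using sums1(2) sums2(2) by (simp add: sum_subtractf scaleR_diff_left)
    ultimately have "affine_dependent S"
      unfolding affine_dependent_explicit_finite[OF S(1)] using that
      by (intro exI[of _ "\<lambda>s. measure \<nu>1 {s} - measure \<nu>2 {s}"]) auto
    then show False using S(2) by simp
  qed
  then have "herglotz \<nu>1 z = herglotz \<nu>2 z" for z
    by (cases "z \<in> ball 0 1") (simp add: sums1(3) sums2(3), simp add: herglotz_def)
  then show False using ne \<phi> by auto
qed

section \<open>Measures with four support points\<close>

context circle_measure
begin

lemma wherglotz_linear:
  assumes u: "u \<in> borel_measurable borel" "\<And>\<zeta>. norm \<zeta> = 1 \<Longrightarrow> \<bar>u \<zeta>\<bar> \<le> C"
    and v: "v \<in> borel_measurable borel" "\<And>\<zeta>. norm \<zeta> = 1 \<Longrightarrow> \<bar>v \<zeta>\<bar> \<le> D"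
    and z: "norm z < 1"
  shows "wherglotz (\<lambda>\<zeta>. a * u \<zeta> + b * v \<zeta>) z = of_real a * wherglotz u z + of_real b * wherglotz v z"
proof -
  note int = integrable_wherglotz[OF u z] integrable_wherglotz[OF v z]
  have "wherglotz (\<lambda>\<zeta>. a * u \<zeta> + b * v \<zeta>) z =
      (\<integral>\<zeta>. of_real a * (of_real (u \<zeta>) * ((\<zeta> + z) / (\<zeta> - z))) + of_real b * (of_real (v \<zeta>) * ((\<zeta> + z) / (\<zeta> - z))) \<partial>M)"
    unfolding wherglotz_def of_real_add of_real_mult ring_distribs mult.assoc ..
  then show ?thesis
    unfolding wherglotz_def
    using int by (simp only: Bochner_Integration.integral_add integrable_mult_right integral_mult_right_zero)
qed

text \<open>At distance at least \<open>\<delta>\<close> from the places where \<open>w\<close> is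
  nonzero, the Poisson kernel is at most \<open>(1 - norm z ^ 2) / \<delta> ^ 2\<close>. The real
  part thus decays at the boundary at a uniform rate.\<close>

lemma abs_Re_wherglotz_le:
  assumes w: "w \<in> borel_measurable borel" "\<And>\<zeta>. norm \<zeta> = 1 \<Longrightarrow> \<bar>w \<zeta>\<bar> \<le> C"
    and z: "norm z < 1" and \<delta>: "\<delta> > 0"
    and far: "\<And>\<zeta>. norm \<zeta> = 1 \<Longrightarrow> w \<zeta> \<noteq> 0 \<Longrightarrow> \<delta> \<le> norm (\<zeta> - z)"
  shows "\<bar>Re (wherglotz w z)\<bar> \<le> C / \<delta> ^ 2 * measure M (space M) * (1 - norm z ^ 2)"
proof -
  have zz: "norm z ^ 2 < 1" using z by (simp add: abs_square_less_1)
  have C: "C \<ge> 0" using w(2)[of 1] by simp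
  have "\<bar>Re (wherglotz w z)\<bar> \<le> (\<integral>\<zeta>. \<bar>w \<zeta> * ((1 - norm z ^ 2) / norm (\<zeta> - z) ^ 2)\<bar> \<partial>M)"
    using integral_abs_bound[of M "\<lambda>\<zeta>. w \<zeta> * ((1 - norm z ^ 2) / norm (\<zeta> - z) ^ 2)"]
      Re_wherglotz(2)[OF w z] by presburger
  also have "\<dots> \<le> (\<integral>\<zeta>. C * ((1 - norm z ^ 2) / \<delta> ^ 2) \<partial>M)"
  proof (rule integral_mono)
    show "integrable M (\<lambda>\<zeta>. \<bar>w \<zeta> * ((1 - norm z ^ 2) / norm (\<zeta> - z) ^ 2)\<bar>)"
      using Re_wherglotz(1)[OF w z] by (rule integrable_abs)
    fix \<zeta> assume "\<zeta> \<in> space M"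
    then have \<zeta>: "norm \<zeta> = 1" by (rule norm_eq_1)
    show "\<bar>w \<zeta> * ((1 - norm z ^ 2) / norm (\<zeta> - z) ^ 2)\<bar> \<le> C * ((1 - norm z ^ 2) / \<delta> ^ 2)"
    proof (cases "w \<zeta> = 0")
      case False
      have "(1 - norm z ^ 2) / norm (\<zeta> - z) ^ 2 \<le> (1 - norm z ^ 2) / \<delta> ^ 2"
        using far[OF \<zeta> False] \<delta> zz by (intro divide_left_mono power_mono mult_pos_pos) auto
      moreover have "0 \<le> (1 - norm z ^ 2) / norm (\<zeta> - z) ^ 2" using zz by simp
      ultimately show ?thesis
        unfolding abs_mult using w(2)[OF \<zeta>] C by (intro mult_mono) auto
    qed (use C zz in simp)
  qed simp
  finally show ?thesis by (simp add: mult_ac)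
qed

text \<open>If the transform of \<open>w\<close> vanished, then so would the boundary values of the Poisson integral of
  the piece of the measure near \<open>p\<close>: off that piece by its own kernel, and near it because the piece
  is minus the rest, which is a positive distance away. The maximum principle for \<open>exp\<close> of the transform
  then forces the mass of the piece to be \<open>0\<close>.\<close>

lemma wherglotz_nonzero:
  assumes w: "w \<in> borel_measurable borel" "\<And>\<zeta>. norm \<zeta> = 1 \<Longrightarrow> \<bar>w \<zeta>\<bar> \<le> C"
    and \<delta>: "\<delta> > 0" and c: "c \<noteq> 0"
    and near: "\<And>\<zeta>. norm \<zeta> = 1 \<Longrightarrow> dist p \<zeta> < \<delta> \<Longrightarrow> w \<zeta> = c"
    and gap: "\<And>\<zeta>. norm \<zeta> = 1 \<Longrightarrow> \<delta> \<le> dist p \<zeta> \<Longrightarrow> dist p \<zeta> < 3 * \<delta> \<Longrightarrow> w \<zeta> = 0"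
    and mass: "measure M (ball p \<delta> \<inter> sphere 0 1) > 0"
  shows "\<exists>z\<in>ball 0 1. wherglotz w z \<noteq> 0"
proof (rule ccontr)
  assume "\<not> ?thesis"
  then have zero: "wherglotz w z = 0" if "norm z < 1" for z using that by simp
  define e :: "complex \<Rightarrow> real" where "e = indicator (ball p \<delta>)"
  \<comment> \<open>What is left of \<open>w\<close> after removing its piece near \<open>p\<close>;
    on the circle it is zero within \<open>3 * \<delta>\<close> of \<open>p\<close>. The factor
    \<open>1 *\<close> fits the shape of \<open>wherglotz_linear\<close>.\<close>
  define u where "u \<zeta> = 1 * w \<zeta> + (- c) * e \<zeta>" for \<zeta>
  note [measurable] = w(1)
  have e: "e \<in> borel_measurable borel" "\<bar>e \<zeta>\<bar> \<le> 1" for \<zeta>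
    unfolding e_def by (auto intro!: borel_measurable_indicator simp: indicator_def)
  have u: "u \<in> borel_measurable borel" "norm \<zeta> = 1 \<Longrightarrow> \<bar>u \<zeta>\<bar> \<le> C + \<bar>c\<bar>" for \<zeta>
  proof -
    show "u \<in> borel_measurable borel" unfolding u_def using w(1) e(1) by measurable
    show "\<bar>u \<zeta>\<bar> \<le> C + \<bar>c\<bar>" if "norm \<zeta> = 1"
      using w(2)[OF that] by (auto simp: u_def e_def indicator_def)
  qed
  have C: "C \<ge> 0" using w(2)[of 1] by simp
  \<comment> \<open>One constant for both estimates below: the bound for \<open>u\<close> divided by
    \<open>\<bar>c\<bar>\<close>, which exceeds the bound for \<open>e\<close> because
    \<open>(C + \<bar>c\<bar>) / \<bar>c\<bar> \<ge> 1\<close>.\<close>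
  define K where "K = (C + \<bar>c\<bar>) / \<bar>c\<bar> / \<delta> ^ 2 * measure M (space M)"
  have "measure M (ball p \<delta> \<inter> sphere 0 1) \<le> measure M (space M)"
    by (rule bounded_measure)
  then have K: "K > 0" unfolding K_def using mass C c \<delta> by (intro mult_pos_pos divide_pos_pos) auto
  have lin: "wherglotz u z = - (of_real c * wherglotz e z)" if "norm z < 1" for z
    unfolding u_def using wherglotz_linear[OF w e that, of 1 "- c"] zero[OF that] by simp
  \<comment> \<open>The radius \<open>2 * \<delta>\<close> is halfway across the ring: beyond it
    \<open>z\<close> is at least \<open>\<delta>\<close> away from the piece \<open>e\<close>, and
    inside it \<open>z\<close> is at least \<open>\<delta>\<close> away from the remainder
    \<open>u\<close>, whose transform is that of \<open>e\<close> times \<open>- c\<close>.\<close>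
  have bound: "Re (wherglotz e z) \<le> K * (1 - norm z ^ 2)" if z: "norm z < 1" for z
  proof (cases "2 * \<delta> \<le> dist p z")
    case True
    have "\<bar>Re (wherglotz e z)\<bar> \<le> 1 / \<delta> ^ 2 * measure M (space M) * (1 - norm z ^ 2)"
    proof (rule abs_Re_wherglotz_le[OF e z \<delta>])
      fix \<zeta> assume "e \<zeta> \<noteq> 0"
      then have "dist p \<zeta> < \<delta>" by (auto simp: e_def indicator_def split: if_splits)
      then show "\<delta> \<le> norm (\<zeta> - z)" using True dist_triangle[of p z \<zeta>] by (simp add: dist_norm)
    qed
    also have "\<dots> \<le> K * (1 - norm z ^ 2)"
      unfolding K_def using z C c by (intro mult_right_mono divide_right_mono) (auto simp: abs_square_le_1 divide_simps)
    finally show ?thesis by simp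
  next
    case False
    have "\<bar>Re (wherglotz u z)\<bar> \<le> (C + \<bar>c\<bar>) / \<delta> ^ 2 * measure M (space M) * (1 - norm z ^ 2)"
    proof (rule abs_Re_wherglotz_le[OF u z \<delta>])
      fix \<zeta> :: complex assume \<zeta>: "norm \<zeta> = 1" "u \<zeta> \<noteq> 0"
      have "3 * \<delta> \<le> dist p \<zeta>"
        using near[OF \<zeta>(1)] gap[OF \<zeta>(1)] \<zeta>(2)
        by (cases "dist p \<zeta> < \<delta>"; cases "dist p \<zeta> < 3 * \<delta>") (auto simp: u_def e_def)
      then show "\<delta> \<le> norm (\<zeta> - z)" using False dist_triangle[of p \<zeta> z] by (simp add: dist_norm norm_minus_commute)
    qed simp
    moreover have "\<bar>Re (wherglotz u z)\<bar> = \<bar>c\<bar> * \<bar>Re (wherglotz e z)\<bar>"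
      by (simp add: lin[OF z] abs_mult)
    moreover have "(C + \<bar>c\<bar>) / \<delta> ^ 2 * measure M (space M) * (1 - norm z ^ 2) = \<bar>c\<bar> * (K * (1 - norm z ^ 2))"
      using c by (simp add: K_def)
    ultimately have "\<bar>Re (wherglotz e z)\<bar> \<le> K * (1 - norm z ^ 2)"
      using c by simp
    then show ?thesis by simp
  qed
  define m where "m = measure M (ball p \<delta> \<inter> sphere 0 1)"
  have w0: "Re (wherglotz e 0) = m"
    using wherglotz_eq[OF e, of 0] by (simp add: e_def m_def space_M)
  \<comment> \<open>The norm of \<open>exp\<close> of the transform is \<open>exp\<close> of its
    real part, so the maximum modulus principle on radius \<open>r\<close> bounds the value at 0,
    where the real part is the mass \<open>m\<close>.\<close>
  have le: "m \<le> K * (1 - r ^ 2)" if r: "0 < r" "r < 1" for r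
  proof -
    have holo: "(\<lambda>z. exp (wherglotz e z)) holomorphic_on ball 0 1"
      by (intro holomorphic_intros wherglotz_holomorphic[OF e])
    have "norm (exp (wherglotz e 0)) \<le> exp (K * (1 - r ^ 2))"
    proof (rule maximum_modulus_frontier[of "\<lambda>z. exp (wherglotz e z)" "cball 0 r" _ 0])
      show "(\<lambda>z. exp (wherglotz e z)) holomorphic_on interior (cball 0 r)"
        by (rule holomorphic_on_subset[OF holo]) (use r in auto)
      show "continuous_on (closure (cball 0 r)) (\<lambda>z. exp (wherglotz e z))"
        by (rule continuous_on_subset[OF holomorphic_on_imp_continuous_on[OF holo]]) (use r in auto)
      fix z :: complex assume "z \<in> frontier (cball 0 r)"
      then have "norm z = r" using r by (simp add: frontier_cball)
      then show "norm (exp (wherglotz e z)) \<le> exp (K * (1 - r ^ 2))"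
        using bound[of z] r by simp
    qed (use r in auto)
    then show ?thesis by (simp add: w0)
  qed
  \<comment> \<open>\<open>\<eta>\<close> plays the role of \<open>1 - r ^ 2\<close>. It is small
    enough that \<open>K * \<eta> \<le> m / 2\<close>, and at most 1/2 so that
    \<open>r = sqrt (1 - \<eta>)\<close> lies strictly between 0 and 1.\<close>
  define \<eta> where "\<eta> = min (1 / 2) (m / (2 * K))"
  have m: "m > 0" using mass by (simp add: m_def)
  have \<eta>: "0 < \<eta>" "\<eta> \<le> 1 / 2" "\<eta> \<le> m / (2 * K)" using m K by (auto simp: \<eta>_def)
  have "m \<le> K * (1 - sqrt (1 - \<eta>) ^ 2)"
    using \<eta> by (intro le) auto
  also have "\<dots> = K * \<eta>" using \<eta> by simp
  also have "\<dots> \<le> K * (m / (2 * K))" using \<eta> K by (intro mult_left_mono) auto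
  also have "\<dots> = m / 2" using K by simp
  finally show False using m by simp
qed

lemma wherglotz_perturbation_not_extreme:
  assumes M: "M \<in> circle_measures"
    and w: "w \<in> borel_measurable borel" "\<And>\<zeta>. norm \<zeta> = 1 \<Longrightarrow> \<bar>w \<zeta>\<bar> \<le> 1"
    and w0: "(\<integral>\<zeta>. w \<zeta> \<partial>M) = 0" "(\<integral>\<zeta>. of_real (w \<zeta>) * cnj \<zeta> \<partial>M) = 0"
    and nz: "\<exists>z\<in>ball 0 1. wherglotz w z \<noteq> 0"
  shows "\<not> herglotz M extreme_point_of pos_disk"
proof -
  interpret prob_space M using M by (simp add: circle_measures_def)
  \<comment> \<open>The density \<open>1 + t * w\<close>, nonnegative for
    \<open>\<bar>t\<bar> \<le> 1\<close> since \<open>\<bar>w\<bar> \<le> 1\<close> on the circle;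
    \<open>t = 1\<close> and \<open>t = - 1\<close> give the ends of the segment. It is written with
    \<open>1 * 1\<close> to match \<open>wherglotz_linear\<close>.\<close>
  define \<phi> where "\<phi> t = (\<lambda>z. if z \<in> ball 0 1 then wherglotz (\<lambda>\<zeta>. 1 * 1 + t * w \<zeta>) z else 0)" for t
  note [measurable] = w(1)
  have [measurable]: "cnj \<in> borel_measurable borel"
    by (intro borel_measurable_continuous_onI continuous_intros)
  have int: "integrable M w" "integrable M (\<lambda>\<zeta>. of_real (w \<zeta>) * cnj \<zeta>)" "integrable M cnj"
    using w(2) by (auto intro!: integrable_boundedI[of _ 1] simp: norm_mult)
  have in_pos: "\<phi> t \<in> pos_disk" if t: "\<bar>t\<bar> \<le> 1" for t
    unfolding \<phi>_def
  proof (rule wherglotz_in_pos_disk)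
    show "(\<lambda>\<zeta>. 1 * 1 + t * w \<zeta>) \<in> borel_measurable borel" by measurable
    fix \<zeta> :: complex assume "norm \<zeta> = 1"
    then have "\<bar>t\<bar> * \<bar>w \<zeta>\<bar> \<le> 1 * 1" using w(2) t by (intro mult_mono) auto
    then have "\<bar>t * w \<zeta>\<bar> \<le> 1" by (simp add: abs_mult)
    then show "\<bar>1 * 1 + t * w \<zeta>\<bar> \<le> 2" "0 \<le> 1 * 1 + t * w \<zeta>" by linarith+
  next
    show "(\<integral>\<zeta>. 1 * 1 + t * w \<zeta> \<partial>M) = 1" using int w0 prob_space by simp
    have "(\<integral>\<zeta>. of_real (1 * 1 + t * w \<zeta>) * cnj \<zeta> \<partial>M) = (\<integral>\<zeta>. cnj \<zeta> + of_real t * (of_real (w \<zeta>) * cnj \<zeta>) \<partial>M)"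
      by (simp add: algebra_simps)
    also have "\<dots> = (\<integral>\<zeta>. cnj \<zeta> \<partial>M) + of_real t * (\<integral>\<zeta>. of_real (w \<zeta>) * cnj \<zeta> \<partial>M)"
      using int by (simp only: Bochner_Integration.integral_add integrable_mult_right integral_mult_right_zero)
    also have "\<dots> = 0" using w0(2) M by (simp only: circle_measures_def mem_Collect_eq) simp
    finally show "(\<integral>\<zeta>. of_real (1 * 1 + t * w \<zeta>) * cnj \<zeta> \<partial>M) = 0" .
  qed
  have eq: "\<phi> t z = wherglotz (\<lambda>_. 1) z + of_real t * wherglotz w z" if "norm z < 1" for t z
    unfolding \<phi>_def using wherglotz_linear[of "\<lambda>_. 1" 1 w 1 z 1 t] w that by simp
  have "herglotz M = (1 - 1 / 2) *\<^sub>R \<phi> 1 + (1 / 2 :: real) *\<^sub>R \<phi> (- 1)"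
  proof
    fix z show "herglotz M z = ((1 - 1 / 2) *\<^sub>R \<phi> 1 + (1 / 2 :: real) *\<^sub>R \<phi> (- 1)) z"
    proof (cases "norm z < 1")
      case True
      then show ?thesis by (simp add: herglotz_eq_wherglotz[OF M] eq scaleR_conv_of_real algebra_simps)
    qed (simp add: herglotz_def \<phi>_def)
  qed
  moreover have "\<phi> 1 \<noteq> \<phi> (- 1)"
  proof
    assume *: "\<phi> 1 = \<phi> (- 1)"
    obtain z where z: "norm z < 1" "wherglotz w z \<noteq> 0" using nz by auto
    then show False using fun_cong[OF *, of z] eq[OF z(1)] by simp
  qed
  ultimately have "herglotz M \<in> open_segment (\<phi> 1) (\<phi> (- 1))"
    unfolding in_segment by (intro conjI exI[of _ "1 / 2"]) auto
  then show ?thesis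
    using in_pos[of 1] in_pos[of "- 1"] by (auto simp: extreme_point_of_def)
qed

section \<open>The topological support and the bound on its size\<close>

definition topological_support :: "complex set"
  where "topological_support = {\<zeta> \<in> sphere 0 1. \<forall>\<epsilon>>0. measure M (ball \<zeta> \<epsilon> \<inter> sphere 0 1) > 0}"

text \<open>Each point of the circle outside the support has a ball of measure 0; by the Lindelof
  property countably many such balls cover them all.\<close>

lemma null_outside_support: "emeasure M (space M - topological_support) = 0"
proof -
  define \<F> where "\<F> = {ball \<zeta> \<epsilon> |\<zeta> \<epsilon>. measure M (ball \<zeta> \<epsilon> \<inter> sphere 0 1) = 0}"
  obtain \<F>' where F: "\<F>' \<subseteq> \<F>" "countable \<F>'" "\<Union>\<F>' = \<Union>\<F>"
    using Lindelof[of \<F>] by (auto simp: \<F>_def)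
  have "(\<Union>B\<in>\<F>'. B \<inter> sphere 0 1) \<in> null_sets M"
  proof (rule null_sets_UN'[OF F(2)])
    fix B assume "B \<in> \<F>'"
    then obtain \<zeta> \<epsilon> where "B = ball \<zeta> \<epsilon>" "measure M (B \<inter> sphere 0 1) = 0" using F(1) by (auto simp: \<F>_def)
    then show "B \<inter> sphere 0 1 \<in> null_sets M"
      by (intro null_setsI) (auto simp: emeasure_eq_measure intro!: Int_sphere_in_sets)
  qed
  moreover have "space M - topological_support \<subseteq> (\<Union>B\<in>\<F>'. B \<inter> sphere 0 1)"
  proof
    fix \<zeta> assume \<zeta>: "\<zeta> \<in> space M - topological_support"
    then obtain \<epsilon> where "\<epsilon> > 0" "measure M (ball \<zeta> \<epsilon> \<inter> sphere 0 1) = 0"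
      by (auto simp: topological_support_def space_M not_less measure_le_0_iff)
    then have "\<zeta> \<in> \<Union>\<F>" by (auto simp: \<F>_def intro!: exI[of _ "ball \<zeta> \<epsilon>"])
    then have "\<zeta> \<in> \<Union>\<F>'" using F(3) by simp
    then show "\<zeta> \<in> (\<Union>B\<in>\<F>'. B \<inter> sphere 0 1)" using \<zeta> by (auto simp: space_M)
  qed
  ultimately show ?thesis
    by (meson emeasure_eq_0 null_setsD1 null_setsD2)
qed

text \<open>A ball around \<open>s\<close> that misses the other support points carries positive
  mass, and almost all of it sits at \<open>s\<close>.\<close>

lemma consists_of_atoms_support:
  assumes fin: "finite topological_support"
  shows "consists_of_atoms M topological_support"
  unfolding consists_of_atoms_def
proof (intro conjI ballI null_outside_support)
  show "topological_support \<subseteq> space M" by (auto simp: topological_support_def space_M)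
  fix s assume s: "s \<in> topological_support"
  obtain \<epsilon> where \<epsilon>: "\<epsilon> > 0" "\<And>x. x \<in> topological_support \<Longrightarrow> x \<noteq> s \<Longrightarrow> \<epsilon> \<le> dist s x"
    using finite_set_avoid[OF fin, of s] by auto
  have s1: "norm s = 1" using s by (simp add: topological_support_def)
  have "0 < measure M (ball s \<epsilon> \<inter> sphere 0 1)"
    using s \<epsilon>(1) by (simp add: topological_support_def)
  also have "\<dots> = measure M {s}"
  proof (rule finite_measure_eq_AE)
    have "AE \<zeta> in M. \<zeta> \<in> topological_support"
    proof (rule AE_I[OF _ null_outside_support])
      have "{s} \<in> sets M" if "s \<in> topological_support" for s
        using that by (intro singleton_in_sets) (simp add: topological_support_def)
      then show "space M - topological_support \<in> sets M"
        using sets.finite_UN[OF fin, of "\<lambda>s. {s}" M] by auto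
    qed auto
    then show "AE \<zeta> in M. \<zeta> \<in> ball s \<epsilon> \<inter> sphere 0 1 \<longleftrightarrow> \<zeta> \<in> {s}"
      by eventually_elim (use \<epsilon> s1 in force)
  qed (auto intro: Int_sphere_in_sets singleton_in_sets s1)
  finally show "0 < measure M {s}" .
qed

lemma four_support_points_not_extreme:
  fixes p :: "4 \<Rightarrow> complex"
  assumes M: "M \<in> circle_measures" and p: "inj p" "\<And>i. p i \<in> topological_support"
  shows "\<not> herglotz M extreme_point_of pos_disk"
proof -
  define d where "d = Min ((\<lambda>(i, j). dist (p i) (p j)) ` {(i, j). i \<noteq> j})"
  \<comment> \<open>A quarter of the least distance: another centre is at least
    \<open>4 * \<delta>\<close> away, so its ball of radius \<open>\<delta>\<close> stays outside
    radius \<open>3 * \<delta>\<close>. This provides the ring required by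
    \<open>wherglotz_nonzero\<close>.\<close>
  define \<delta> where "\<delta> = d / 4"
  have ne: "{(i, j). i \<noteq> (j :: 4)} \<noteq> {}" using zero_neq_one[where 'a = 4] by blast
  have sep: "4 * \<delta> \<le> dist (p i) (p j)" if "i \<noteq> j" for i j
    unfolding \<delta>_def d_def using that by (simp, intro Min_le) auto
  have "d > 0"
    unfolding d_def using ne p(1) by (subst Min_gr_iff) (auto simp: inj_def)
  then have \<delta>: "\<delta> > 0" by (simp add: \<delta>_def)
  define e :: "4 \<Rightarrow> complex \<Rightarrow> real" where "e i = indicator (ball (p i) \<delta>)" for i
  have e[measurable]: "e i \<in> borel_measurable borel" and e1: "\<bar>e i \<zeta>\<bar> \<le> 1" for i \<zeta>
    unfolding e_def by (auto intro!: borel_measurable_indicator simp: indicator_def)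
  \<comment> \<open>Collects mass and conjugate moment of the combination with coefficients
    \<open>x\<close>. Its target has real dimension 3, so the kernel is nontrivial.\<close>
  define T :: "real ^ 4 \<Rightarrow> real \<times> complex" where
    "T x = (\<Sum>i\<in>UNIV. x $ i *\<^sub>R (\<integral>\<zeta>. e i \<zeta> \<partial>M, \<integral>\<zeta>. of_real (e i \<zeta>) * cnj \<zeta> \<partial>M))" for x
  have lin: "linear T"
    unfolding T_def by (intro linear_compose_sum ballI linearI) (auto simp: scaleR_add_left ring_distribs)
  have "\<not> inj T"
  proof
    assume "inj T"
    then have "dim (range T) = dim (UNIV :: (real ^ 4) set)"
      using dim_image_eq[OF lin, of UNIV] by simp
    moreover have "dim (range T) \<le> DIM(real \<times> complex)"
      by (rule dim_subset_UNIV)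
    ultimately show False by simp
  qed
  then obtain x where x: "T x = 0" "x \<noteq> 0" using linear_injective_0[OF lin] by auto
  \<comment> \<open>Normalized so that all coefficients are at most 1 in absolute value; as the
    balls are disjoint, \<open>w\<close> inherits the bound that keeps \<open>1 + w\<close> and
    \<open>1 - w\<close> nonnegative.\<close>
  define c where "c i = x $ i / norm x" for i
  have c1: "\<bar>c i\<bar> \<le> 1" for i
    using x(2) component_le_norm_cart[of x i] by (simp add: c_def divide_simps)
  obtain k where "c k \<noteq> 0" using x(2) by (auto simp: c_def vec_eq_iff)
  define w where "w \<zeta> = (\<Sum>i\<in>UNIV. c i * e i \<zeta>)" for \<zeta>
  have w_meas: "w \<in> borel_measurable borel" unfolding w_def by measurable
  have e_unique: "j = i" if "norm (\<zeta> - p i) < 3 * \<delta>" "e j \<zeta> \<noteq> 0" for i j \<zeta>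
  proof (rule ccontr)
    assume "j \<noteq> i"
    have "dist (p j) \<zeta> < \<delta>" using that(2) by (auto simp: e_def indicator_def split: if_splits)
    moreover have "4 * \<delta> \<le> dist (p j) (p i)" using sep[OF \<open>j \<noteq> i\<close>] .
    ultimately show False
      using that(1) dist_triangle[of "p j" "p i" \<zeta>] by (simp add: dist_norm)
  qed
  have w_eq: "w \<zeta> = c i * e i \<zeta>" if "norm (\<zeta> - p i) < 3 * \<delta>" for i \<zeta>
  proof -
    have *: "c j * e j \<zeta> = (if j = i then c i * e i \<zeta> else 0)" for j
    proof (cases "j = i")
      case False
      then have "e j \<zeta> = 0" using e_unique[OF that] by blast
      then show ?thesis using False by simp
    qed simp
    have "w \<zeta> = (\<Sum>j\<in>UNIV. if j = i then c i * e i \<zeta> else 0)"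
      unfolding w_def by (rule sum.cong[OF refl]) (rule *)
    then show ?thesis by simp
  qed
  have w_le: "\<bar>w \<zeta>\<bar> \<le> 1" for \<zeta>
  proof (cases "\<exists>i. e i \<zeta> \<noteq> 0")
    case True
    then obtain i where "e i \<zeta> \<noteq> 0" by blast
    then have "dist (p i) \<zeta> < \<delta>" by (simp add: e_def indicator_def split: if_splits)
    then have "w \<zeta> = c i * e i \<zeta>" using \<delta> by (intro w_eq) (simp add: dist_norm norm_minus_commute)
    then show ?thesis using mult_mono[OF c1[of i] e1[of i \<zeta>]] by (simp add: abs_mult)
  qed (simp add: w_def)
  have int_e: "integrable M (e i)" "integrable M (\<lambda>\<zeta>. of_real (e i \<zeta>) * cnj \<zeta>)" for i
  proof -
    have [measurable]: "cnj \<in> borel_measurable borel"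
      by (intro borel_measurable_continuous_onI continuous_intros)
    show "integrable M (e i)" "integrable M (\<lambda>\<zeta>. of_real (e i \<zeta>) * cnj \<zeta>)"
      using e1 by (auto intro!: integrable_boundedI[of _ 1] simp: norm_mult)
  qed
  show ?thesis
  proof (rule wherglotz_perturbation_not_extreme[OF M w_meas w_le])
    have "(\<integral>\<zeta>. w \<zeta> \<partial>M) = (\<Sum>i\<in>UNIV. c i * (\<integral>\<zeta>. e i \<zeta> \<partial>M))"
      unfolding w_def using int_e by simp
    also have "\<dots> = fst (T x) / norm x"
      by (simp add: T_def c_def fst_sum sum_divide_distrib)
    finally show "(\<integral>\<zeta>. w \<zeta> \<partial>M) = 0" using x(1) by simp
    have "(\<integral>\<zeta>. of_real (w \<zeta>) * cnj \<zeta> \<partial>M) = (\<integral>\<zeta>. (\<Sum>i\<in>UNIV. of_real (c i) * (of_real (e i \<zeta>) * cnj \<zeta>)) \<partial>M)"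
      unfolding w_def by (simp only: of_real_sum of_real_mult sum_distrib_right mult.assoc)
    also have "\<dots> = (\<Sum>i\<in>UNIV. of_real (c i) * (\<integral>\<zeta>. of_real (e i \<zeta>) * cnj \<zeta> \<partial>M))"
      by (subst Bochner_Integration.integral_sum)
        (intro integrable_mult_right int_e(2), simp only: integral_mult_right_zero)
    also have "\<dots> = snd (T x) / norm x"
      by (simp add: T_def c_def snd_sum sum_divide_distrib scaleR_conv_of_real)
    finally show "(\<integral>\<zeta>. of_real (w \<zeta>) * cnj \<zeta> \<partial>M) = 0" using x(1) by simp
    show "\<exists>z\<in>ball 0 1. wherglotz w z \<noteq> 0"
    proof (rule wherglotz_nonzero[OF w_meas w_le \<delta> \<open>c k \<noteq> 0\<close>])
      fix \<zeta> assume "dist (p k) \<zeta> < \<delta>"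
      then show "w \<zeta> = c k"
        using w_eq[of \<zeta> k] \<delta> by (simp add: e_def dist_norm norm_minus_commute)
    next
      fix \<zeta> assume "\<delta> \<le> dist (p k) \<zeta>" "dist (p k) \<zeta> < 3 * \<delta>"
      then show "w \<zeta> = 0"
        using w_eq[of \<zeta> k] by (simp add: e_def dist_norm norm_minus_commute)
    next
      show "measure M (ball (p k) \<delta> \<inter> sphere 0 1) > 0"
        using p(2)[of k] \<delta> by (simp add: topological_support_def)
    qed
  qed
qed

lemma extreme_imp_support_card_le_3:
  assumes M: "M \<in> circle_measures" and ext: "herglotz M extreme_point_of pos_disk"
  shows "finite topological_support \<and> card topological_support \<le> 3"
proof (rule ccontr)
  assume large: "\<not> ?thesis"
  obtain T where T: "T \<subseteq> topological_support" "finite T" "card T = 4"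
  proof (cases "finite topological_support")
    case True
    then have "4 \<le> card topological_support" using large by simp
    then show ?thesis by (rule obtain_subset_with_card_n) (use that in blast)
  next
    case False
    then show ?thesis using that infinite_arbitrarily_large[of topological_support 4] by blast
  qed
  obtain p :: "4 \<Rightarrow> complex" where "bij_betw p UNIV T"
    using finite_same_card_bij[of "UNIV :: 4 set" T] T by auto
  then have "inj p" "\<And>i. p i \<in> topological_support"
    using T(1) unfolding bij_betw_def by blast+
  then show False using four_support_points_not_extreme[OF M] ext by blast
qed

end

section \<open>Balanced measures with at most three atoms\<close>

lemma not_collinear_unit_circle:
  fixes a b c :: complex
  assumes "norm a = 1" "norm b = 1" "norm c = 1" and ne: "a \<noteq> b" "b \<noteq> c" "a \<noteq> c"
  shows "\<not> collinear {a, b, c}"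
proof -
  \<comment> \<open>Strict convexity of the disk: a point in the open segment is closer to 0 than
    one of the endpoints, so its norm is below 1.\<close>
  have *: "\<not> between (x, y) z" if "norm x = 1" "norm y = 1" "norm z = 1" "z \<noteq> x" "z \<noteq> y" for x y z :: complex
  proof
    assume "between (x, y) z"
    then have "z \<in> open_segment x y" using that by (simp add: between_mem_segment open_segment_def)
    then show False using dist_decreases_open_segment[of z x y 0] that by simp
  qed
  show ?thesis unfolding collinear_between_cases
    using *[of b c a] *[of c a b] *[of a b c] assms by simp
qed

text \<open>No atoms contradicts total mass 1, and a single atom contradicts balance. Two atoms
  balance only if opposite and equal. For three atoms the masses are strictly positive barycentric
  coordinates of 0, which places 0 in the interior of the triangle.\<close>

lemma atoms_card_le_3_cases:
  assumes \<mu>: "\<mu> \<in> circle_measures" and atoms: "consists_of_atoms \<mu> S"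
    and S: "finite S" "card S \<le> 3"
  shows "two_antipodal_atoms \<mu> \<or> three_triangle_atoms \<mu>"
proof -
  interpret circle_measure \<mu> by (rule circle_measure_circle_measures[OF \<mu>])
  have SS: "S \<subseteq> sphere 0 1" and pos: "\<And>s. s \<in> S \<Longrightarrow> measure \<mu> {s} > 0"
    and null: "emeasure \<mu> (space \<mu> - S) = 0"
    using atoms by (auto simp: consists_of_atoms_def space_M)
  note sums = circle_measures_finite_support_sums(1,2)[OF \<mu> S(1) SS null]
  consider "card S = 0" | "card S = 1" | "card S = 2" | "card S = 3" using S(2) by linarith
  then show ?thesis
  proof cases
    case 1
    then show ?thesis using sums S by simp
  next
    case 2
    then obtain s where "S = {s}" by (auto simp: card_1_singleton_iff)
    then show ?thesis using sums SS by auto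
  next
    case 3
    then obtain a b where ab: "S = {a, b}" "a \<noteq> b" by (auto simp: card_2_iff)
    have n: "norm a = 1" "norm b = 1" using SS ab by auto
    have s1: "measure \<mu> {a} + measure \<mu> {b} = 1" using sums(1) ab by simp
    have s2: "measure \<mu> {a} *\<^sub>R a = - (measure \<mu> {b} *\<^sub>R b)"
      using sums(2) ab by (simp add: add_eq_0_iff)
    \<comment> \<open>Both atoms have norm 1, so comparing norms in the balance equation equates the
      masses.\<close>
    then have "norm (measure \<mu> {a} *\<^sub>R a) = norm (measure \<mu> {b} *\<^sub>R b)" by simp
    then have "measure \<mu> {a} = measure \<mu> {b}" using n by simp
    then have half: "measure \<mu> {a} = 1 / 2" "measure \<mu> {b} = 1 / 2" using s1 by auto
    then have "(1 / 2) *\<^sub>R b = (1 / 2) *\<^sub>R (- a)"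
      using s2 unfolding half by (simp only: scaleR_minus_right minus_minus)
    then have "b = - a" by (simp only: scaleR_cancel_left) simp
    then show ?thesis
      using half atoms ab unfolding two_antipodal_atoms_def by blast
  next
    case 4
    then obtain a b c where abc: "S = {a, b, c}" "a \<noteq> b" "b \<noteq> c" "a \<noteq> c" by (auto simp: card_3_iff)
    have "\<not> collinear {a, b, c}"
      using SS abc by (intro not_collinear_unit_circle) auto
    then have "\<not> affine_dependent S" using abc by (simp add: collinear_3_eq_affine_dependent)
    then have "interior (convex hull S) = {y. \<exists>u. (\<forall>x\<in>S. 0 < u x) \<and> sum u S = 1 \<and> (\<Sum>x\<in>S. u x *\<^sub>R x) = y}"
      by (subst interior_convex_hull_explicit_minimal) (use 4 in auto)
    moreover have "(\<forall>x\<in>S. 0 < measure \<mu> {x}) \<and> (\<Sum>x\<in>S. measure \<mu> {x}) = 1 \<and> (\<Sum>x\<in>S. measure \<mu> {x} *\<^sub>R x) = 0"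
      using sums pos by blast
    ultimately have "0 \<in> interior (convex hull S)"
      by (auto intro!: exI[of _ "\<lambda>x. measure \<mu> {x}"])
    then show ?thesis using atoms abc unfolding three_triangle_atoms_def by blast
  qed
qed

lemma extreme_point_of_pos_disk_iff:
  assumes \<mu>: "\<mu> \<in> circle_measures"
  shows "herglotz \<mu> extreme_point_of pos_disk \<longleftrightarrow> two_antipodal_atoms \<mu> \<or> three_triangle_atoms \<mu>"
proof
  interpret circle_measure \<mu> by (rule circle_measure_circle_measures[OF \<mu>])
  assume "herglotz \<mu> extreme_point_of pos_disk"
  then show "two_antipodal_atoms \<mu> \<or> three_triangle_atoms \<mu>"
    using extreme_imp_support_card_le_3[OF \<mu>] consists_of_atoms_support atoms_card_le_3_cases[OF \<mu>] by blast
next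
  assume "two_antipodal_atoms \<mu> \<or> three_triangle_atoms \<mu>"
  then obtain S where "consists_of_atoms \<mu> S" "finite S" "\<not> affine_dependent S"
  proof
    assume "two_antipodal_atoms \<mu>"
    then obtain \<zeta> where "consists_of_atoms \<mu> {\<zeta>, - \<zeta>}" unfolding two_antipodal_atoms_def by blast
    then show ?thesis using that affine_independent_2 by blast
  next
    assume "three_triangle_atoms \<mu>"
    then obtain a b c where abc: "0 \<in> interior (convex hull {a, b, c})" "consists_of_atoms \<mu> {a, b, c}"
      unfolding three_triangle_atoms_def by blast
    \<comment> \<open>A hull of at most two points has empty interior in the plane, so
      \<open>a\<close>, \<open>b\<close>, \<open>c\<close> are distinct; for exactly three points a
      nonempty interior is equivalent to affine independence.\<close>
    have "\<not> card {a, b, c} \<le> DIM(complex)"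
      using empty_interior_convex_hull[of "{a, b, c}"] abc(1) by auto
    then have "card {a, b, c} = Suc DIM(complex)"
      using card_insert_le_m1[of 3 "{b, c}" a] card_insert_le_m1[of 2 "{c}" b] by simp
    then have "\<not> affine_dependent {a, b, c}"
      using interior_convex_hull_eq_empty[of "{a, b, c}"] abc(1) by auto
    then show ?thesis using that abc(2) by blast
  qed
  then show "herglotz \<mu> extreme_point_of pos_disk" by (rule herglotz_extreme_point[OF \<mu>])
qed

theorem mainTheorem6:
  shows "convex pos_V2 \<and>
    linear (\<lambda>F :: complex \<times> complex \<Rightarrow> complex. F \<circ> h2) \<and>
    bij_betw (\<lambda>F. F \<circ> h2) pos_V2 pos_disk \<and>
    (\<forall>\<phi>\<in>pos_disk. \<exists>\<mu>\<in>circle_measures. \<phi> = herglotz \<mu>) \<and>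
    {\<phi>. \<phi> extreme_point_of pos_disk} =
      herglotz ` {\<mu>\<in>circle_measures. two_antipodal_atoms \<mu> \<or> three_triangle_atoms \<mu>} \<and>
    (\<forall>\<mu>\<in>circle_measures. herglotz \<mu> extreme_point_of pos_disk \<longleftrightarrow>
      two_antipodal_atoms \<mu> \<or> three_triangle_atoms \<mu>)"
proof (intro conjI)
  show "{\<phi>. \<phi> extreme_point_of pos_disk} =
      herglotz ` {\<mu>\<in>circle_measures. two_antipodal_atoms \<mu> \<or> three_triangle_atoms \<mu>}" (is "?L = ?R")
  proof (intro equalityI subsetI)
    fix \<phi> assume "\<phi> \<in> ?L"
    then have ext: "\<phi> extreme_point_of pos_disk" by simp
    then have "\<phi> \<in> pos_disk" by (simp add: extreme_point_of_def)
    then obtain \<mu> where "\<mu> \<in> circle_measures" "\<phi> = herglotz \<mu>"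
      using herglotz_representation by blast
    then show "\<phi> \<in> ?R" using ext extreme_point_of_pos_disk_iff by blast
  next
    fix \<phi> assume "\<phi> \<in> ?R"
    then show "\<phi> \<in> ?L" using extreme_point_of_pos_disk_iff by blast
  qed
qed (use convex_pos_V2 linear_comp_right bij_betw_comp_h2 herglotz_representation
  extreme_point_of_pos_disk_iff in blast)+

end
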